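(* Let $t_0<t_1$ be real numbers, let $X\neq\{0\}$ be a Banach space, and let $\alpha>0$. If $p=1$ or $p=\infty$, then $$N_{\alpha,p}=\frac{(t_1-t_0)^\alpha}{\Gamma(\alpha+1)}.$$
   Context: $L^p(t_0,t_1;X)$ is the Bochner-Lebesgue space on $[t_0,t_1]$ with its usual norm. For $\alpha>0$, $J^\alpha_{t_0,t}$ is the bounded linear operator from $L^p(t_0,t_1;X)$ into itself sending $f$ to the (a.e. defined) function $t\mapsto J^\alpha_{t_0,t}f(t):=\frac{1}{\Gamma(\alpha)}\int_{t_0}^t(t-s)^{\alpha-1}f(s)\,ds$ (Bochner integral). $N_{\alpha,p}$ denotes its operator norm: $N_{\alpha,p}=\sup_{\phi\in L^p(t_0,t_1;X),\,\phi\ne0}\frac{\|J^\alpha_{t_0,t}\phi\|_{L^p(t_0,t_1;X)}}{\|\phi\|_{L^p(t_0,t_1;X)}}$. *)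

theory Defs
  imports "HOL-Probability.Essential_Supremum"
begin

text \<open>
  The library's Bochner integral \<^const>\<open>has_bochner_integral\<close> is restricted to second countable
  (hence separable) spaces.  The following definitions cover functions with values in an arbitrary
  normed space, where strong measurability no longer coincides with Borel measurability.
\<close>

definition strongly_measurable :: "'a measure \<Rightarrow> ('a \<Rightarrow> 'b::real_normed_vector) \<Rightarrow> bool" where
  "strongly_measurable M f \<longleftrightarrow>
     (\<exists>s :: nat \<Rightarrow> 'a \<Rightarrow> 'b. (\<forall>i. simple_function M (s i)) \<and>
       (AE x in M. (\<lambda>i. s i x) \<longlonglongrightarrow> f x))"

definition bochner_has_integral ::
    "'a measure \<Rightarrow> ('a \<Rightarrow> 'b::real_normed_vector) \<Rightarrow> 'b \<Rightarrow> bool" where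
  "bochner_has_integral M f y \<longleftrightarrow> strongly_measurable M f \<and>
     (\<exists>s :: nat \<Rightarrow> 'a \<Rightarrow> 'b.
       (\<forall>i. Bochner_Integration.simple_bochner_integrable M (s i)) \<and>
       (\<lambda>i. \<integral>\<^sup>+x. ennreal (norm (f x - s i x)) \<partial>M) \<longlonglongrightarrow> 0 \<and>
       (\<lambda>i. Bochner_Integration.simple_bochner_integral M (s i)) \<longlonglongrightarrow> y)"

definition bochner_integral :: "'a measure \<Rightarrow> ('a \<Rightarrow> 'b::real_normed_vector) \<Rightarrow> 'b" where
  "bochner_integral M f =
     (if \<exists>y. bochner_has_integral M f y then THE y. bochner_has_integral M f y else 0)"

text \<open>For a complete measure, such as \<^term>\<open>lebesgue_on S\<close> with measurable \<open>S\<close>, this agrees with the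
  library notion whenever the latter is available.\<close>

lemma bochner_has_integral_iff_has_bochner_integral:
  fixes f :: "'a \<Rightarrow> 'b::{real_normed_vector, second_countable_topology}"
  assumes "complete_measure M"
  shows "bochner_has_integral M f y \<longleftrightarrow> has_bochner_integral M f y"
proof -
  interpret complete_measure M by fact
  have "strongly_measurable M f \<longleftrightarrow> f \<in> borel_measurable M"
  proof
    assume "strongly_measurable M f"
    then obtain s :: "nat \<Rightarrow> 'a \<Rightarrow> 'b" where s: "\<And>i. simple_function M (s i)"
      and lim: "AE x in M. (\<lambda>i. s i x) \<longlonglongrightarrow> f x"
      unfolding strongly_measurable_def by blast
    define N where "N = {x \<in> space M. \<not> (\<lambda>i. s i x) \<longlonglongrightarrow> f x}"
    have N: "N \<in> null_sets M"
      using lim unfolding N_def AE_iff_null_sets .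
    define g where "g = (\<lambda>x. if x \<in> N then 0 else f x)"
    have "g \<in> borel_measurable M"
    proof (rule borel_measurable_LIMSEQ_metric)
      show "(\<lambda>x. if x \<in> N then 0 else s i x) \<in> borel_measurable M" for i
        using N borel_measurable_simple_function[OF s[of i]] by (intro measurable_If_set) auto
      show "(\<lambda>i. if x \<in> N then 0 else s i x) \<longlonglongrightarrow> g x" if "x \<in> space M" for x
        using that by (simp add: g_def N_def)
    qed
    have eq: "AE x in M. g x = f x"
      using AE_not_in[OF N] by eventually_elim (simp add: g_def)
    show "f \<in> borel_measurable M"
    proof (rule measurableI)
      fix A :: "'b set" assume A: "A \<in> sets borel"
      show "f -` A \<inter> space M \<in> sets M"
      proof (rule in_sets_AE)
        show "g -` A \<inter> space M \<in> sets M"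
          using \<open>g \<in> borel_measurable M\<close> A by (rule measurable_sets)
        show "AE x in M. x \<in> g -` A \<inter> space M \<longleftrightarrow> x \<in> f -` A \<inter> space M"
          using eq by eventually_elim simp
      qed simp
    qed simp
  next
    assume "f \<in> borel_measurable M"
    then show "strongly_measurable M f"
      using borel_measurable_implies_sequence_metric[of f M 0]
      unfolding strongly_measurable_def by (blast intro: AE_I2)
  qed
  then show ?thesis
    unfolding bochner_has_integral_def has_bochner_integral.simps by simp
qed

text \<open>Elements of $L^p$ are represented by functions rather than by equivalence classes;
  \<^term>\<open>Lp_norm p M f\<close> depends only on the class of \<open>f\<close> modulo null sets.\<close>

definition Lp_norm :: "ennreal \<Rightarrow> 'a measure \<Rightarrow> ('a \<Rightarrow> 'b::real_normed_vector) \<Rightarrow> ennreal" where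
  "Lp_norm p M f =
     (if p = \<infinity> then esssup M (\<lambda>x. ennreal (norm (f x)))
      else let I = \<integral>\<^sup>+x. ennreal (norm (f x) powr enn2real p) \<partial>M
           in if I = \<infinity> then \<infinity> else ennreal (enn2real I powr (1 / enn2real p)))"

definition Lp_space :: "ennreal \<Rightarrow> 'a measure \<Rightarrow> ('a \<Rightarrow> 'b::real_normed_vector) set" where
  "Lp_space p M = {f. strongly_measurable M f \<and> Lp_norm p M f < \<infinity>}"

definition Lp_opnorm ::
    "ennreal \<Rightarrow> 'a measure \<Rightarrow> (('a \<Rightarrow> 'b::real_normed_vector) \<Rightarrow> 'a \<Rightarrow> 'b) \<Rightarrow> ennreal" where
  "Lp_opnorm p M T =
     (SUP \<phi> \<in> {\<phi> \<in> Lp_space p M. \<not> (AE x in M. \<phi> x = 0)}. Lp_norm p M (T \<phi>) / Lp_norm p M \<phi>)"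

definition RL_integral ::
    "real \<Rightarrow> real \<Rightarrow> (real \<Rightarrow> 'b::real_normed_vector) \<Rightarrow> real \<Rightarrow> 'b" where
  "RL_integral \<alpha> t0 f t =
     (1 / Gamma \<alpha>) *\<^sub>R
       bochner_integral (lebesgue_on {t0..t}) (\<lambda>s. ((t - s) powr (\<alpha> - 1)) *\<^sub>R f s)"

end

theory Submission
  imports Defs
begin

text \<open>
  Write \<open>T = t1 - t0\<close> and \<open>k(r) = r powr (\<alpha> - 1)\<close>, so that \<open>\<Gamma>(\<alpha>) J f\<close> is the convolution of \<open>f\<close> with \<open>k\<close>
  started at \<open>t0\<close>.  The number \<open>T powr \<alpha> / \<Gamma>(\<alpha> + 1)\<close> is \<open>1 / \<Gamma>(\<alpha>)\<close> times the mass of \<open>k\<close> on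
  \<open>{0..T}\<close>.  It bounds the operator norm by Young's inequality, and both end point cases are sharp
  because the whole mass of the kernel can be picked up.

  For \<open>p = \<infinity>\<close>, the norm of \<open>J f(t)\<close> is at most \<open>(t - t0) powr \<alpha> / \<Gamma>(\<alpha> + 1)\<close> times the norm of
  \<open>f\<close>, and constant functions give equality at every \<open>t\<close>; the bound increases to the claimed value at
  \<open>t = t1\<close>.  For \<open>p = 1\<close>, Tonelli's
  theorem (\<open>nn_integral_abel_kernel_Tonelli\<close>) exchanges the roles of the variables: a unit mass
  at \<open>s\<close> is spread to total mass \<open>(t1 - s) powr \<alpha> / \<Gamma>(\<alpha> + 1)\<close>, which is largest at \<open>s = t0\<close>, so
  indicators of short intervals \<open>{t0..b}\<close> exhaust the bound.  In both cases the lower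
  bound is first proved with \<open>u < t1\<close> in place of \<open>t1\<close> (\<open>le_RL_opnorm_1\<close>,
  \<open>le_RL_opnorm_infinity\<close>), and then \<open>u\<close> tends to \<open>t1\<close>.

  Two points need work beyond these estimates.  The space of values need not be separable, so the
  basic facts on Bochner integrals of strongly measurable functions (norm inequality, uniqueness,
  existence, differences, restriction of the domain) are derived here from simple functions.
  And the essential supremum is infinite on functions that are not measurable, so
  the upper bound for \<open>p = \<infinity>\<close> requires \<open>norm (J f(t))\<close> to be measurable in \<open>t\<close>.  This follows
  from continuity (\<open>continuous_on_RL_integral\<close>), which holds because translating the
  kernel changes it little in \<open>L\<^sup>1\<close> (\<open>nn_integral_abel_kernel_diff_le\<close>).
\<close>

section \<open>Strong measurability\<close>

text \<open>On a complete measure space the pointwise limit, which is measurable, may be altered on a null set.\<close>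

lemma borel_measurable_AE_limit:
  fixes u :: "nat \<Rightarrow> 'a \<Rightarrow> real"
  assumes "complete_measure M" and u: "\<And>i. u i \<in> borel_measurable M"
    and lim: "AE x in M. (\<lambda>i. u i x) \<longlonglongrightarrow> g x"
  shows "g \<in> borel_measurable M"
proof -
  interpret complete_measure M by fact
  note u[measurable]
  have g': "(\<lambda>x. lim (\<lambda>i. u i x)) \<in> borel_measurable M"
    by measurable
  have eq: "AE x in M. lim (\<lambda>i. u i x) = g x"
    using lim by eventually_elim (rule limI)
  show ?thesis
  proof (rule measurableI)
    fix A :: "real set" assume A: "A \<in> sets borel"
    show "g -` A \<inter> space M \<in> sets M"
    proof (rule in_sets_AE)
      show "(\<lambda>x. lim (\<lambda>i. u i x)) -` A \<inter> space M \<in> sets M"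
        using g' A by (rule measurable_sets)
      show "AE x in M. x \<in> (\<lambda>x. lim (\<lambda>i. u i x)) -` A \<inter> space M \<longleftrightarrow> x \<in> g -` A \<inter> space M"
        using eq by eventually_elim simp
    qed simp
  qed simp
qed

lemma simple_function_norm_borel:
  fixes s :: "'a \<Rightarrow> 'b::real_normed_vector"
  assumes "simple_function M s"
  shows "(\<lambda>x. norm (s x)) \<in> borel_measurable M"
  using simple_function_compose1[OF assms, of norm] by (rule borel_measurable_simple_function)

lemma simple_function_imp_strongly_measurable:
  "simple_function M s \<Longrightarrow> strongly_measurable M s"
  unfolding strongly_measurable_def by (rule exI[of _ "\<lambda>_. s"]) simp

lemma strongly_measurable_compose2:
  fixes f :: "'a \<Rightarrow> 'b::real_normed_vector" and g :: "'a \<Rightarrow> 'c::real_normed_vector"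
    and h :: "'b \<Rightarrow> 'c \<Rightarrow> 'd::real_normed_vector"
  assumes f: "strongly_measurable M f" and g: "strongly_measurable M g"
    and h: "\<And>x y u v. u \<longlonglongrightarrow> x \<Longrightarrow> v \<longlonglongrightarrow> y \<Longrightarrow> (\<lambda>i::nat. h (u i) (v i)) \<longlonglongrightarrow> h x y"
  shows "strongly_measurable M (\<lambda>x. h (f x) (g x))"
proof -
  obtain s where s: "\<And>i. simple_function M (s i)" "AE x in M. (\<lambda>i::nat. s i x) \<longlonglongrightarrow> f x"
    using f unfolding strongly_measurable_def by blast
  obtain r where r: "\<And>i. simple_function M (r i)" "AE x in M. (\<lambda>i::nat. r i x) \<longlonglongrightarrow> g x"
    using g unfolding strongly_measurable_def by blast
  have "AE x in M. (\<lambda>i. h (s i x) (r i x)) \<longlonglongrightarrow> h (f x) (g x)"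
    using s(2) r(2) by eventually_elim (rule h)
  then show ?thesis
    unfolding strongly_measurable_def using s(1) r(1) simple_function_compose2
    by (intro exI[of _ "\<lambda>i x. h (s i x) (r i x)"]) blast
qed

lemma strongly_measurable_diff:
  fixes f g :: "'a \<Rightarrow> 'b::real_normed_vector"
  assumes "strongly_measurable M f" "strongly_measurable M g"
  shows "strongly_measurable M (\<lambda>x. f x - g x)"
  using assms by (rule strongly_measurable_compose2) (rule tendsto_diff)

lemma strongly_measurable_scaleR:
  fixes f :: "'a \<Rightarrow> real" and g :: "'a \<Rightarrow> 'b::real_normed_vector"
  assumes "strongly_measurable M f" "strongly_measurable M g"
  shows "strongly_measurable M (\<lambda>x. f x *\<^sub>R g x)"
  using assms by (rule strongly_measurable_compose2) (rule tendsto_scaleR)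

lemma borel_measurable_imp_strongly_measurable:
  fixes f :: "'a \<Rightarrow> real"
  assumes "f \<in> borel_measurable M"
  shows "strongly_measurable M f"
  using borel_measurable_implies_sequence_metric[OF assms, of 0]
  unfolding strongly_measurable_def by (blast intro: AE_I2)

text \<open>This is the form of measurability that additivity of the nonnegative integral requires in the
  estimates of \<open>L\<^sup>1\<close> distances.\<close>

lemma strongly_measurable_norm:
  assumes "complete_measure M" and "strongly_measurable M f"
  shows "(\<lambda>x. norm (f x)) \<in> borel_measurable M"
proof -
  obtain s where s: "\<And>i. simple_function M (s i)" "AE x in M. (\<lambda>i::nat. s i x) \<longlonglongrightarrow> f x"
    using assms(2) unfolding strongly_measurable_def by blast
  have "AE x in M. (\<lambda>i. norm (s i x)) \<longlonglongrightarrow> norm (f x)"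
    using s(2) by eventually_elim (rule tendsto_norm)
  then show ?thesis
    by (rule borel_measurable_AE_limit[OF assms(1) simple_function_norm_borel[OF s(1)]])
qed

lemma simple_function_indicator_scaleR:
  fixes s :: "'a \<Rightarrow> 'b::real_normed_vector"
  assumes \<Omega>: "\<Omega> \<inter> space M \<in> sets M" and s: "simple_function M s"
  shows "simple_function M (\<lambda>x. indicator \<Omega> x *\<^sub>R s x)"
proof -
  have "simple_function M (\<lambda>x. indicator (\<Omega> \<inter> space M) x *\<^sub>R s x)"
    by (rule simple_function_compose2[OF simple_function_indicator[OF \<Omega>] s])
  moreover have "simple_function M (\<lambda>x. indicator (\<Omega> \<inter> space M) x *\<^sub>R s x) \<longleftrightarrow>
      simple_function M (\<lambda>x. indicator \<Omega> x *\<^sub>R s x)"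
    by (rule simple_function_cong) (simp split: split_indicator)
  ultimately show ?thesis by blast
qed

text \<open>Extending by zero lets all integrals be taken over the same measure space, so that integrals over
  different intervals can be subtracted.\<close>

lemma strongly_measurable_restrict_space_iff:
  fixes f :: "'a \<Rightarrow> 'b::real_normed_vector"
  assumes \<Omega>: "\<Omega> \<inter> space M \<in> sets M"
  shows "strongly_measurable (restrict_space M \<Omega>) f \<longleftrightarrow>
         strongly_measurable M (\<lambda>x. indicator \<Omega> x *\<^sub>R f x)"
proof
  assume "strongly_measurable (restrict_space M \<Omega>) f"
  then obtain s :: "nat \<Rightarrow> 'a \<Rightarrow> 'b" where s: "\<And>i. simple_function (restrict_space M \<Omega>) (s i)"
    "AE x in restrict_space M \<Omega>. (\<lambda>i. s i x) \<longlonglongrightarrow> f x"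
    unfolding strongly_measurable_def by blast
  have "AE x in M. (\<lambda>i. indicator \<Omega> x *\<^sub>R s i x) \<longlonglongrightarrow> indicator \<Omega> x *\<^sub>R f x"
    using s(2) unfolding AE_restrict_space_iff[OF \<Omega>]
    by eventually_elim (auto split: split_indicator)
  with s(1) show "strongly_measurable M (\<lambda>x. indicator \<Omega> x *\<^sub>R f x)"
    unfolding strongly_measurable_def simple_function_restrict_space[OF \<Omega>]
    by (intro exI[of _ "\<lambda>i x. indicator \<Omega> x *\<^sub>R s i x"]) blast
next
  assume "strongly_measurable M (\<lambda>x. indicator \<Omega> x *\<^sub>R f x)"
  then obtain s :: "nat \<Rightarrow> 'a \<Rightarrow> 'b" where s: "\<And>i. simple_function M (s i)"
    "AE x in M. (\<lambda>i. s i x) \<longlonglongrightarrow> indicator \<Omega> x *\<^sub>R f x"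
    unfolding strongly_measurable_def by blast
  have "simple_function (restrict_space M \<Omega>) (s i)" for i
    unfolding simple_function_restrict_space[OF \<Omega>]
    by (rule simple_function_indicator_scaleR[OF \<Omega> s(1)])
  moreover have "AE x in restrict_space M \<Omega>. (\<lambda>i. s i x) \<longlonglongrightarrow> f x"
    using s(2) unfolding AE_restrict_space_iff[OF \<Omega>]
    by eventually_elim (auto split: split_indicator_asm)
  ultimately show "strongly_measurable (restrict_space M \<Omega>) f"
    unfolding strongly_measurable_def by blast
qed

section \<open>The Bochner integral of strongly measurable functions\<close>

abbreviation simple_integrable :: "'a measure \<Rightarrow> ('a \<Rightarrow> 'b::real_vector) \<Rightarrow> bool"
  where "simple_integrable \<equiv> Bochner_Integration.simple_bochner_integrable"
abbreviation simple_integral :: "'a measure \<Rightarrow> ('a \<Rightarrow> 'b::real_vector) \<Rightarrow> 'b"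
  where "simple_integral \<equiv> Bochner_Integration.simple_bochner_integral"

lemma norm_simple_bochner_integral_le:
  fixes s :: "'a \<Rightarrow> 'b::real_normed_vector"
  assumes "simple_integrable M s"
  shows "ennreal (norm (simple_integral M s)) \<le> (\<integral>\<^sup>+x. ennreal (norm (s x)) \<partial>M)"
proof -
  have "simple_integrable M (\<lambda>x. norm (s x))"
    using simple_bochner_integrable_compose2[of "\<lambda>x y. norm x" M s s] assms by simp
  then have "ennreal (simple_integral M (\<lambda>x. norm (s x))) = (\<integral>\<^sup>+x. ennreal (norm (s x)) \<partial>M)"
    by (rule simple_bochner_integral_eq_nn_integral) simp
  then show ?thesis
    using simple_bochner_integral_norm_bound[OF assms] by (metis ennreal_leI)
qed

lemma norm_simple_bochner_integral_diff_le:
  fixes s :: "'a \<Rightarrow> 'b::real_normed_vector"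
  assumes "simple_integrable M s" "simple_integrable M r"
  shows "ennreal (norm (simple_integral M s - simple_integral M r))
    \<le> (\<integral>\<^sup>+x. ennreal (norm (s x - r x)) \<partial>M)"
  using norm_simple_bochner_integral_le[OF simple_bochner_integrable_compose2[of "(-)", OF _ assms]]
  by (simp add: simple_bochner_integral_diff[OF assms])

lemma simple_bochner_integrable_imp_simple_function:
  "simple_integrable M s \<Longrightarrow> simple_function M s"
  by (erule Bochner_Integration.simple_bochner_integrable.cases)

text \<open>Pass to the limit in \<open>norm (\<integral>s\<^sub>i) \<le> \<integral>norm s\<^sub>i \<le> \<integral>norm f + \<integral>norm (f - s\<^sub>i)\<close>.\<close>

lemma bochner_has_integral_norm_le:
  fixes f :: "'a \<Rightarrow> 'b::real_normed_vector"
  assumes M: "complete_measure M" and "bochner_has_integral M f y"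
  shows "ennreal (norm y) \<le> (\<integral>\<^sup>+x. ennreal (norm (f x)) \<partial>M)"
proof -
  from assms(2) obtain s :: "nat \<Rightarrow> 'a \<Rightarrow> 'b" where f: "strongly_measurable M f"
    and s: "\<And>i. simple_integrable M (s i)"
    and lim: "(\<lambda>i. \<integral>\<^sup>+x. ennreal (norm (f x - s i x)) \<partial>M) \<longlonglongrightarrow> 0"
      "(\<lambda>i. simple_integral M (s i)) \<longlonglongrightarrow> y"
    unfolding bochner_has_integral_def by blast
  note sf = simple_bochner_integrable_imp_simple_function[OF s]
  have [measurable]: "(\<lambda>x. norm (f x)) \<in> borel_measurable M"
    by (rule strongly_measurable_norm[OF M f])
  have [measurable]: "(\<lambda>x. norm (f x - s i x)) \<in> borel_measurable M" for i
    by (rule strongly_measurable_norm[OF M strongly_measurable_diff[OF f]])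
       (simp_all add: simple_function_imp_strongly_measurable sf)
  have bound: "ennreal (norm (simple_integral M (s i)))
      \<le> (\<integral>\<^sup>+x. ennreal (norm (f x)) \<partial>M) + (\<integral>\<^sup>+x. ennreal (norm (f x - s i x)) \<partial>M)" for i
  proof -
    have "ennreal (norm (simple_integral M (s i))) \<le> (\<integral>\<^sup>+x. ennreal (norm (s i x)) \<partial>M)"
      by (rule norm_simple_bochner_integral_le[OF s])
    also have "\<dots> \<le> (\<integral>\<^sup>+x. ennreal (norm (f x)) + ennreal (norm (f x - s i x)) \<partial>M)"
    proof (rule nn_integral_mono)
      fix x
      have "norm (s i x) \<le> norm (f x) + norm (f x - s i x)"
        using norm_triangle_ineq4[of "f x" "f x - s i x"] by simp
      then show "ennreal (norm (s i x)) \<le> ennreal (norm (f x)) + ennreal (norm (f x - s i x))"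
        by (simp flip: ennreal_plus)
    qed
    also have "\<dots> = (\<integral>\<^sup>+x. ennreal (norm (f x)) \<partial>M) + (\<integral>\<^sup>+x. ennreal (norm (f x - s i x)) \<partial>M)"
      by (rule nn_integral_add) simp_all
    finally show ?thesis .
  qed
  show ?thesis
  proof (rule LIMSEQ_le)
    show "(\<lambda>i. ennreal (norm (simple_integral M (s i)))) \<longlonglongrightarrow> ennreal (norm y)"
      by (intro tendsto_ennrealI tendsto_norm lim)
    show "(\<lambda>i. (\<integral>\<^sup>+x. ennreal (norm (f x)) \<partial>M) + (\<integral>\<^sup>+x. ennreal (norm (f x - s i x)) \<partial>M))
        \<longlonglongrightarrow> (\<integral>\<^sup>+x. ennreal (norm (f x)) \<partial>M)"
      using tendsto_add[OF tendsto_const lim(1)] by simp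
  qed (use bound in blast)
qed

lemma bochner_has_integral_diff:
  fixes f g :: "'a \<Rightarrow> 'b::real_normed_vector"
  assumes M: "complete_measure M" and fy: "bochner_has_integral M f y" and gz: "bochner_has_integral M g z"
  shows "bochner_has_integral M (\<lambda>x. f x - g x) (y - z)"
proof -
  from fy obtain s :: "nat \<Rightarrow> 'a \<Rightarrow> 'b" where f: "strongly_measurable M f"
    and s: "\<And>i. simple_integrable M (s i)"
    and s_lim: "(\<lambda>i. \<integral>\<^sup>+x. ennreal (norm (f x - s i x)) \<partial>M) \<longlonglongrightarrow> 0"
      "(\<lambda>i. simple_integral M (s i)) \<longlonglongrightarrow> y"
    unfolding bochner_has_integral_def by blast
  from gz obtain r :: "nat \<Rightarrow> 'a \<Rightarrow> 'b" where g: "strongly_measurable M g"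
    and r: "\<And>i. simple_integrable M (r i)"
    and r_lim: "(\<lambda>i. \<integral>\<^sup>+x. ennreal (norm (g x - r i x)) \<partial>M) \<longlonglongrightarrow> 0"
      "(\<lambda>i. simple_integral M (r i)) \<longlonglongrightarrow> z"
    unfolding bochner_has_integral_def by blast
  have [measurable]: "(\<lambda>x. norm (f x - s i x)) \<in> borel_measurable M" for i
    by (rule strongly_measurable_norm[OF M strongly_measurable_diff[OF f]])
       (simp_all add: simple_function_imp_strongly_measurable simple_bochner_integrable_imp_simple_function s)
  have [measurable]: "(\<lambda>x. norm (g x - r i x)) \<in> borel_measurable M" for i
    by (rule strongly_measurable_norm[OF M strongly_measurable_diff[OF g]])
       (simp_all add: simple_function_imp_strongly_measurable simple_bochner_integrable_imp_simple_function r)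
  have "(\<lambda>i. \<integral>\<^sup>+x. ennreal (norm ((f x - g x) - (s i x - r i x))) \<partial>M) \<longlonglongrightarrow> 0"
  proof (rule tendsto_sandwich[OF _ _ tendsto_const])
    show "(\<lambda>i. (\<integral>\<^sup>+x. ennreal (norm (f x - s i x)) \<partial>M) + (\<integral>\<^sup>+x. ennreal (norm (g x - r i x)) \<partial>M)) \<longlonglongrightarrow> 0"
      using tendsto_add[OF s_lim(1) r_lim(1)] by simp
    have "(\<integral>\<^sup>+x. ennreal (norm ((f x - g x) - (s i x - r i x))) \<partial>M)
        \<le> (\<integral>\<^sup>+x. ennreal (norm (f x - s i x)) + ennreal (norm (g x - r i x)) \<partial>M)" for i
    proof (rule nn_integral_mono)
      fix x
      have "norm ((f x - g x) - (s i x - r i x)) \<le> norm (f x - s i x) + norm (g x - r i x)"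
        using norm_triangle_ineq4[of "f x - s i x" "g x - r i x"] by (simp add: algebra_simps)
      then show "ennreal (norm ((f x - g x) - (s i x - r i x))) \<le> ennreal (norm (f x - s i x)) + ennreal (norm (g x - r i x))"
        by (simp flip: ennreal_plus)
    qed
    then show "\<forall>\<^sub>F i in sequentially. (\<integral>\<^sup>+x. ennreal (norm ((f x - g x) - (s i x - r i x))) \<partial>M)
        \<le> (\<integral>\<^sup>+x. ennreal (norm (f x - s i x)) \<partial>M) + (\<integral>\<^sup>+x. ennreal (norm (g x - r i x)) \<partial>M)"
      by (simp add: nn_integral_add)
  qed simp
  moreover have "simple_integrable M (\<lambda>x. s i x - r i x)" for i
    using s r by (rule simple_bochner_integrable_compose2[rotated]) simp
  moreover have "(\<lambda>i. simple_integral M (\<lambda>x. s i x - r i x)) \<longlonglongrightarrow> y - z"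
    using tendsto_diff[OF s_lim(2) r_lim(2)]
    by (simp add: simple_bochner_integral_diff s r)
  ultimately show ?thesis
    unfolding bochner_has_integral_def using strongly_measurable_diff[OF f g]
    by (intro conjI exI[of _ "\<lambda>i x. s i x - r i x"]) blast+
qed

text \<open>The zero function \<open>f - f\<close> has integral \<open>y - z\<close>, and the norm inequality applies to it.\<close>

lemma bochner_has_integral_unique:
  fixes f :: "'a \<Rightarrow> 'b::real_normed_vector"
  assumes "complete_measure M" "bochner_has_integral M f y" "bochner_has_integral M f z"
  shows "y = z"
  using bochner_has_integral_norm_le[OF assms(1) bochner_has_integral_diff[OF assms]] by simp

lemma bochner_integral_eq:
  fixes f :: "'a \<Rightarrow> 'b::real_normed_vector"
  assumes "complete_measure M" "bochner_has_integral M f y"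
  shows "bochner_integral M f = y"
  using assms bochner_has_integral_unique[OF assms(1)]
  unfolding bochner_integral_def by (auto intro!: the_equality)

text \<open>If the integral does not exist, its default value \<open>0\<close> satisfies the bound as well.\<close>

lemma norm_bochner_integral_le:
  fixes f :: "'a \<Rightarrow> 'b::real_normed_vector"
  assumes "complete_measure M"
  shows "ennreal (norm (bochner_integral M f)) \<le> (\<integral>\<^sup>+x. ennreal (norm (f x)) \<partial>M)"
proof (cases "\<exists>y. bochner_has_integral M f y")
  case True
  then obtain y where y: "bochner_has_integral M f y" ..
  then show ?thesis
    using bochner_integral_eq[OF assms y] bochner_has_integral_norm_le[OF assms y] by simp
next
  case False
  then show ?thesis by (simp add: bochner_integral_def)
qed

lemma bochner_has_integral_scaleR_const:
  fixes c :: "'b::real_normed_vector" and f :: "'a \<Rightarrow> real"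
  assumes f: "f \<in> borel_measurable M" and "has_bochner_integral M f y"
  shows "bochner_has_integral M (\<lambda>x. f x *\<^sub>R c) (y *\<^sub>R c)"
proof -
  from assms(2) obtain s :: "nat \<Rightarrow> 'a \<Rightarrow> real"
    where s: "\<And>i. simple_integrable M (s i)"
    and lim: "(\<lambda>i. \<integral>\<^sup>+x. ennreal (norm (f x - s i x)) \<partial>M) \<longlonglongrightarrow> 0"
      "(\<lambda>i. simple_integral M (s i)) \<longlonglongrightarrow> y"
    unfolding has_bochner_integral.simps by blast
  have [measurable]: "s i \<in> borel_measurable M" for i
    using s by (intro borel_measurable_simple_function simple_bochner_integrable_imp_simple_function)
  note f[measurable]
  have "simple_integrable M (\<lambda>x. s i x *\<^sub>R c)" for i
    using simple_bochner_integrable_compose2[of "\<lambda>x y. x *\<^sub>R c" M "s i" "s i"] s by simp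
  moreover have "(\<lambda>i. \<integral>\<^sup>+x. ennreal (norm (f x *\<^sub>R c - s i x *\<^sub>R c)) \<partial>M) \<longlonglongrightarrow> 0"
  proof -
    have "(\<integral>\<^sup>+x. ennreal (norm (f x *\<^sub>R c - s i x *\<^sub>R c)) \<partial>M)
        = (\<integral>\<^sup>+x. ennreal (norm (f x - s i x)) \<partial>M) * ennreal (norm c)" for i
      by (subst nn_integral_multc[symmetric])
         (auto simp: ennreal_mult'' simp flip: scaleR_left_diff_distrib)
    moreover have "(\<lambda>i. ennreal (norm c) * (\<integral>\<^sup>+x. ennreal (norm (f x - s i x)) \<partial>M)) \<longlonglongrightarrow> ennreal (norm c) * 0"
      by (rule ennreal_tendsto_cmult[OF _ lim(1)]) simp
    ultimately show ?thesis by (simp add: mult.commute)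
  qed
  moreover have "(\<lambda>i. simple_integral M (\<lambda>x. s i x *\<^sub>R c)) \<longlonglongrightarrow> y *\<^sub>R c"
    using tendsto_scaleR[OF lim(2) tendsto_const[of c]]
    by (simp add: simple_bochner_integral_linear[OF bounded_linear.linear[OF bounded_linear_scaleR_left] s])
  moreover have "strongly_measurable M (\<lambda>x. f x *\<^sub>R c)"
    by (intro strongly_measurable_scaleR borel_measurable_imp_strongly_measurable f
        simple_function_imp_strongly_measurable simple_function_const)
  ultimately show ?thesis
    unfolding bochner_has_integral_def by (intro conjI exI[of _ "\<lambda>i x. s i x *\<^sub>R c"]) blast+
qed

text \<open>Cutting approximating simple functions off where they exceed \<open>2 * norm (f x)\<close> keeps the pointwise
  convergence and makes them dominated, hence convergent in \<open>L\<^sup>1\<close>; their integrals then form a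
  Cauchy sequence.\<close>

lemma bochner_has_integral_exists:
  fixes f :: "'a \<Rightarrow> 'b::banach"
  assumes M: "complete_measure M" and f: "strongly_measurable M f"
    and fin: "(\<integral>\<^sup>+x. ennreal (norm (f x)) \<partial>M) < \<infinity>"
  shows "\<exists>y. bochner_has_integral M f y"
proof -
  obtain r :: "nat \<Rightarrow> 'a \<Rightarrow> 'b" where r: "\<And>i. simple_function M (r i)"
    and r_lim: "AE x in M. (\<lambda>i. r i x) \<longlonglongrightarrow> f x"
    using f unfolding strongly_measurable_def by blast
  define s where "s i x = (if norm (r i x) \<le> 2 * norm (f x) then r i x else 0)" for i x
  have nf[measurable]: "(\<lambda>x. norm (f x)) \<in> borel_measurable M"
    by (rule strongly_measurable_norm[OF M f])
  have nr[measurable]: "(\<lambda>x. norm (r i x)) \<in> borel_measurable M" for i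
    by (rule simple_function_norm_borel[OF r])
  have s_le: "norm (s i x) \<le> 2 * norm (f x)" for i x
    by (simp add: s_def)
  have sf: "simple_function M (s i)" for i
    unfolding s_def[abs_def] by (intro simple_function_If r simple_function_const) measurable
  have s_lim: "AE x in M. (\<lambda>i. s i x) \<longlonglongrightarrow> f x"
    using r_lim
  proof eventually_elim
    fix x assume lim: "(\<lambda>i. r i x) \<longlonglongrightarrow> f x"
    show "(\<lambda>i. s i x) \<longlonglongrightarrow> f x"
    proof (cases "f x = 0")
      case True
      then have "s i x = 0" for i by (simp add: s_def)
      then show ?thesis using True by simp
    next
      case False
      then have "norm (f x) < 2 * norm (f x)" by simp
      from order_tendstoD(2)[OF tendsto_norm[OF lim] this]
      have "\<forall>\<^sub>F i in sequentially. r i x = s i x"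
        by eventually_elim (simp add: s_def)
      then show ?thesis by (rule Lim_transform_eventually[OF lim])
    qed
  qed
  have s: "simple_integrable M (s i)" for i
  proof (rule simple_bochner_integrableI_bounded[OF sf])
    have "(\<integral>\<^sup>+x. ennreal (norm (s i x)) \<partial>M) \<le> (\<integral>\<^sup>+x. 2 * ennreal (norm (f x)) \<partial>M)"
      using s_le[of i] by (intro nn_integral_mono) (simp add: ennreal_leI flip: ennreal_mult' ennreal_numeral)
    also have "\<dots> < \<infinity>"
      using fin by (simp add: nn_integral_cmult ennreal_mult_less_top)
    finally show "(\<integral>\<^sup>+x. ennreal (norm (s i x)) \<partial>M) < \<infinity>" .
  qed
  have nfs[measurable]: "(\<lambda>x. norm (f x - s i x)) \<in> borel_measurable M" for i
    by (rule strongly_measurable_norm[OF M strongly_measurable_diff[OF f]])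
       (simp_all add: simple_function_imp_strongly_measurable sf)
  have lim0: "(\<lambda>i. \<integral>\<^sup>+x. ennreal (norm (f x - s i x)) \<partial>M) \<longlonglongrightarrow> 0"
  proof -
    have "(\<lambda>i. \<integral>\<^sup>+x. ennreal (norm (f x - s i x)) \<partial>M) \<longlonglongrightarrow> (\<integral>\<^sup>+x. 0 \<partial>M)"
    proof (rule nn_integral_dominated_convergence[where w = "\<lambda>x. 3 * ennreal (norm (f x))"])
      show "(\<integral>\<^sup>+x. 3 * ennreal (norm (f x)) \<partial>M) < \<infinity>"
        using fin by (simp add: nn_integral_cmult ennreal_mult_less_top)
      show "AE x in M. ennreal (norm (f x - s i x)) \<le> 3 * ennreal (norm (f x))" for i
      proof (intro AE_I2)
        fix x
        have "norm (f x - s i x) \<le> 3 * norm (f x)"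
          using norm_triangle_ineq4[of "f x" "s i x"] s_le[of i x] by linarith
        then show "ennreal (norm (f x - s i x)) \<le> 3 * ennreal (norm (f x))"
          by (simp add: ennreal_leI flip: ennreal_mult' ennreal_numeral)
      qed
      show "AE x in M. (\<lambda>i. ennreal (norm (f x - s i x))) \<longlonglongrightarrow> 0"
        using s_lim
      proof eventually_elim
        fix x assume "(\<lambda>i. s i x) \<longlonglongrightarrow> f x"
        from tendsto_norm[OF tendsto_diff[OF tendsto_const[of "f x"] this]]
        show "(\<lambda>i. ennreal (norm (f x - s i x))) \<longlonglongrightarrow> 0"
          by (simp add: tendsto_ennrealI flip: ennreal_0)
      qed
    qed simp_all
    then show ?thesis by simp
  qed
  have "Cauchy (\<lambda>i. simple_integral M (s i))"
  proof (rule metric_CauchyI)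
    fix e :: real assume e: "0 < e"
    then have "\<forall>\<^sub>F i in sequentially. (\<integral>\<^sup>+x. ennreal (norm (f x - s i x)) \<partial>M) < ennreal (e / 2)"
      by (intro order_tendstoD(2)[OF lim0]) simp
    then obtain N where N: "\<And>i. i \<ge> N \<Longrightarrow> (\<integral>\<^sup>+x. ennreal (norm (f x - s i x)) \<partial>M) < ennreal (e / 2)"
      unfolding eventually_sequentially by blast
    have "dist (simple_integral M (s i)) (simple_integral M (s j)) < e"
      if ij: "N \<le> i" "N \<le> j" for i j
    proof -
      have "ennreal (norm (simple_integral M (s i) - simple_integral M (s j)))
          \<le> (\<integral>\<^sup>+x. ennreal (norm (s i x - s j x)) \<partial>M)"
        by (rule norm_simple_bochner_integral_diff_le[OF s s])
      also have "\<dots> \<le> (\<integral>\<^sup>+x. ennreal (norm (f x - s i x)) + ennreal (norm (f x - s j x)) \<partial>M)"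
      proof (rule nn_integral_mono)
        fix x
        have "norm (s i x - s j x) \<le> norm (f x - s i x) + norm (f x - s j x)"
          using norm_triangle_ineq4[of "f x - s j x" "f x - s i x"] by (simp add: algebra_simps)
        then show "ennreal (norm (s i x - s j x)) \<le> ennreal (norm (f x - s i x)) + ennreal (norm (f x - s j x))"
          by (simp flip: ennreal_plus)
      qed
      also have "\<dots> = (\<integral>\<^sup>+x. ennreal (norm (f x - s i x)) \<partial>M) + (\<integral>\<^sup>+x. ennreal (norm (f x - s j x)) \<partial>M)"
        by (rule nn_integral_add) simp_all
      also have "\<dots> < ennreal (e / 2) + ennreal (e / 2)"
        by (intro add_strict_mono N ij)
      also have "\<dots> = ennreal e"
        using e by (simp flip: ennreal_plus)
      finally show ?thesis
        using e by (simp add: dist_norm ennreal_less_iff)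
    qed
    then show "\<exists>N. \<forall>i\<ge>N. \<forall>j\<ge>N. dist (simple_integral M (s i))
        (simple_integral M (s j)) < e"
      by blast
  qed
  then obtain y where "(\<lambda>i. simple_integral M (s i)) \<longlonglongrightarrow> y"
    using Cauchy_convergent convergent_def by blast
  then show ?thesis
    unfolding bochner_has_integral_def using f s lim0 by blast
qed

text \<open>From right to left, the approximating functions need not vanish outside \<open>\<Omega>\<close>, but their integrals
  there are bounded by the approximation error, since the limit function does vanish.\<close>

lemma bochner_has_integral_restrict_space_iff:
  fixes f :: "'a \<Rightarrow> 'b::real_normed_vector"
  assumes \<Omega>: "\<Omega> \<inter> space M \<in> sets M"
  shows "bochner_has_integral (restrict_space M \<Omega>) f y \<longleftrightarrow>
         bochner_has_integral M (\<lambda>x. indicator \<Omega> x *\<^sub>R f x) y"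
proof
  assume "bochner_has_integral (restrict_space M \<Omega>) f y"
  then obtain s :: "nat \<Rightarrow> 'a \<Rightarrow> 'b" where f: "strongly_measurable (restrict_space M \<Omega>) f"
    and s: "\<And>i. simple_integrable (restrict_space M \<Omega>) (s i)"
    and lim: "(\<lambda>i. \<integral>\<^sup>+x. ennreal (norm (f x - s i x)) \<partial>restrict_space M \<Omega>) \<longlonglongrightarrow> 0"
      "(\<lambda>i. simple_integral (restrict_space M \<Omega>) (s i)) \<longlonglongrightarrow> y"
    unfolding bochner_has_integral_def by blast
  have "(\<integral>\<^sup>+x. ennreal (norm (f x - s i x)) \<partial>restrict_space M \<Omega>)
      = (\<integral>\<^sup>+x. ennreal (norm (indicator \<Omega> x *\<^sub>R f x - indicator \<Omega> x *\<^sub>R s i x)) \<partial>M)" for i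
    unfolding nn_integral_restrict_space[OF \<Omega>]
    by (intro nn_integral_cong) (auto split: split_indicator)
  then show "bochner_has_integral M (\<lambda>x. indicator \<Omega> x *\<^sub>R f x) y"
    using f s lim simple_bochner_integral_restrict_space[OF \<Omega> s]
    unfolding bochner_has_integral_def strongly_measurable_restrict_space_iff[OF \<Omega>]
      simple_bochner_integrable_restrict_space[OF \<Omega>]
    by (intro conjI exI[of _ "\<lambda>i x. indicator \<Omega> x *\<^sub>R s i x"]) simp_all
next
  assume "bochner_has_integral M (\<lambda>x. indicator \<Omega> x *\<^sub>R f x) y"
  then obtain s :: "nat \<Rightarrow> 'a \<Rightarrow> 'b"
    where f: "strongly_measurable (restrict_space M \<Omega>) f"
    and s: "\<And>i. simple_integrable M (s i)"
    and lim: "(\<lambda>i. \<integral>\<^sup>+x. ennreal (norm (indicator \<Omega> x *\<^sub>R f x - s i x)) \<partial>M) \<longlonglongrightarrow> 0"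
      "(\<lambda>i. simple_integral M (s i)) \<longlonglongrightarrow> y"
    unfolding bochner_has_integral_def strongly_measurable_restrict_space_iff[OF \<Omega>] by blast
  have s': "simple_integrable M (\<lambda>x. indicator \<Omega> x *\<^sub>R s i x)" for i
  proof -
    have "simple_function M (\<lambda>x. indicator \<Omega> x *\<^sub>R s i x)"
      by (rule simple_function_indicator_scaleR[OF \<Omega> simple_bochner_integrable_imp_simple_function[OF s]])
    moreover have "{x \<in> space M. s i x \<noteq> 0} \<in> sets M"
      using simple_function_norm_borel[OF simple_bochner_integrable_imp_simple_function[OF s[of i]]]
      using borel_measurable_neq[of "\<lambda>x. norm (s i x)" M "\<lambda>x. 0"] by simp
    then have "emeasure M {x \<in> space M. indicator \<Omega> x *\<^sub>R s i x \<noteq> 0} \<le> emeasure M {x \<in> space M. s i x \<noteq> 0}"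
      by (intro emeasure_mono) auto
    moreover have "emeasure M {x \<in> space M. s i x \<noteq> 0} \<noteq> \<infinity>"
      using s[of i] by (auto elim: Bochner_Integration.simple_bochner_integrable.cases)
    ultimately show ?thesis
      by (intro Bochner_Integration.simple_bochner_integrable.intros) (auto simp: top_unique)
  qed
  then have s'': "simple_integrable (restrict_space M \<Omega>) (s i)" for i
    by (simp add: simple_bochner_integrable_restrict_space[OF \<Omega>])
  have "(\<lambda>i. \<integral>\<^sup>+x. ennreal (norm (f x - s i x)) \<partial>restrict_space M \<Omega>) \<longlonglongrightarrow> 0"
  proof (rule tendsto_sandwich[OF _ _ tendsto_const lim(1)])
    show "\<forall>\<^sub>F i in sequentially. (\<integral>\<^sup>+x. ennreal (norm (f x - s i x)) \<partial>restrict_space M \<Omega>)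
        \<le> (\<integral>\<^sup>+x. ennreal (norm (indicator \<Omega> x *\<^sub>R f x - s i x)) \<partial>M)"
      unfolding nn_integral_restrict_space[OF \<Omega>]
      by (intro always_eventually allI nn_integral_mono) (auto split: split_indicator)
  qed simp
  moreover have "(\<lambda>i. simple_integral (restrict_space M \<Omega>) (s i)) \<longlonglongrightarrow> y"
  proof (rule Lim_transform[OF lim(2)])
    let ?d = "\<lambda>i. simple_integral (restrict_space M \<Omega>) (s i)
        - simple_integral M (s i)"
    have "(\<lambda>i. ennreal (norm (?d i))) \<longlonglongrightarrow> 0"
    proof (rule tendsto_sandwich[OF _ _ tendsto_const lim(1)])
      have "ennreal (norm (?d i)) \<le> (\<integral>\<^sup>+x. ennreal (norm (indicator \<Omega> x *\<^sub>R f x - s i x)) \<partial>M)" for i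
      proof -
        have "ennreal (norm (?d i)) \<le> (\<integral>\<^sup>+x. ennreal (norm (indicator \<Omega> x *\<^sub>R s i x - s i x)) \<partial>M)"
          using norm_simple_bochner_integral_diff_le[OF s'[of i] s[of i]]
          by (simp add: simple_bochner_integral_restrict_space[OF \<Omega> s''])
        also have "\<dots> \<le> (\<integral>\<^sup>+x. ennreal (norm (indicator \<Omega> x *\<^sub>R f x - s i x)) \<partial>M)"
          by (intro nn_integral_mono) (auto split: split_indicator)
        finally show ?thesis .
      qed
      then show "\<forall>\<^sub>F i in sequentially. ennreal (norm (?d i))
          \<le> (\<integral>\<^sup>+x. ennreal (norm (indicator \<Omega> x *\<^sub>R f x - s i x)) \<partial>M)" by simp
    qed simp
    then have "(\<lambda>i. norm (?d i)) \<longlonglongrightarrow> 0"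
      by (subst (asm) ennreal_0[symmetric], subst (asm) tendsto_ennreal_iff) simp_all
    then show "?d \<longlonglongrightarrow> 0"
      by (rule tendsto_norm_zero_cancel)
  qed
  ultimately show "bochner_has_integral (restrict_space M \<Omega>) f y"
    unfolding bochner_has_integral_def using f s'' by blast
qed

lemma bochner_integral_restrict_space:
  fixes f :: "'a \<Rightarrow> 'b::real_normed_vector"
  assumes "\<Omega> \<inter> space M \<in> sets M"
  shows "bochner_integral (restrict_space M \<Omega>) f = bochner_integral M (\<lambda>x. indicator \<Omega> x *\<^sub>R f x)"
  unfolding bochner_integral_def bochner_has_integral_restrict_space_iff[OF assms] ..

section \<open>The kernel of the fractional integral\<close>

text \<open>The integrand may be unbounded at \<open>s = t\<close>, but its primitive is continuous there.\<close>

lemma has_integral_powr_diff_left: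
  fixes \<alpha> :: real
  assumes "0 < \<alpha>" "a \<le> b" "b \<le> t"
  shows "((\<lambda>s. (t - s) powr (\<alpha> - 1)) has_integral ((t - a) powr \<alpha> - (t - b) powr \<alpha>) / \<alpha>) {a..b}"
proof -
  have "((\<lambda>s. (t - s) powr (\<alpha> - 1)) has_integral
      (- ((t - b) powr \<alpha>) / \<alpha>) - (- ((t - a) powr \<alpha>) / \<alpha>)) {a..b}"
  proof (rule fundamental_theorem_of_calculus_interior[OF \<open>a \<le> b\<close>])
    show "continuous_on {a..b} (\<lambda>s. - ((t - s) powr \<alpha>) / \<alpha>)"
      using assms by (intro continuous_intros continuous_on_powr') auto
    show "((\<lambda>s. - ((t - s) powr \<alpha>) / \<alpha>) has_vector_derivative (t - s) powr (\<alpha> - 1)) (at s)"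
      if "s \<in> {a<..<b}" for s
      using that assms
      by (auto intro!: derivative_eq_intros simp: has_real_derivative_iff_has_vector_derivative[symmetric]
           powr_diff field_simps)
  qed
  then show ?thesis by (simp add: diff_divide_distrib)
qed

lemma has_integral_powr_diff_right:
  fixes \<alpha> :: real
  assumes "0 < \<alpha>" "s \<le> b"
  shows "((\<lambda>t. (t - s) powr (\<alpha> - 1)) has_integral (b - s) powr \<alpha> / \<alpha>) {s..b}"
proof -
  have "((\<lambda>t. (t - s) powr (\<alpha> - 1)) has_integral
      (b - s) powr \<alpha> / \<alpha> - (s - s) powr \<alpha> / \<alpha>) {s..b}"
  proof (rule fundamental_theorem_of_calculus_interior[OF \<open>s \<le> b\<close>])
    show "continuous_on {s..b} (\<lambda>t. (t - s) powr \<alpha> / \<alpha>)"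
      using assms by (intro continuous_intros continuous_on_powr') auto
    show "((\<lambda>t. (t - s) powr \<alpha> / \<alpha>) has_vector_derivative (t - s) powr (\<alpha> - 1)) (at t)"
      if "t \<in> {s<..<b}" for t
      using that assms
      by (auto intro!: derivative_eq_intros simp: has_real_derivative_iff_has_vector_derivative[symmetric]
           powr_diff field_simps)
  qed
  then show ?thesis using assms by simp
qed

text \<open>
  The cut-off at \<open>s = t\<close> turns the variable domain of integration into a factor of the integrand.
\<close>

definition abel_kernel :: "real \<Rightarrow> real \<Rightarrow> real \<Rightarrow> real \<Rightarrow> real" where
  "abel_kernel \<alpha> t0 t s = indicator {t0..t} s * (t - s) powr (\<alpha> - 1)"

lemma abel_kernel_nonneg [simp]: "0 \<le> abel_kernel \<alpha> t0 t s"
  by (simp add: abel_kernel_def)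

lemma borel_measurable_abel_kernel [measurable]:
  "(\<lambda>(t, s). abel_kernel \<alpha> t0 t s) \<in> borel_measurable (borel \<Otimes>\<^sub>M borel)"
proof -
  have "(\<lambda>(t, s). abel_kernel \<alpha> t0 t s)
      = (\<lambda>(t, s). if t0 \<le> s \<and> s \<le> t then (t - s) powr (\<alpha> - 1) else 0)"
    by (auto simp: abel_kernel_def fun_eq_iff split: split_indicator)
  then show ?thesis by simp
qed

lemma borel_measurable_lebesgue_abel_kernel: "abel_kernel \<alpha> t0 t \<in> borel_measurable lebesgue"
proof -
  have "abel_kernel \<alpha> t0 t \<in> borel_measurable borel" by measurable
  then show ?thesis by (simp add: measurable_completion)
qed

lemma nn_integral_abel_kernel:
  assumes "0 < \<alpha>" "t0 \<le> t"
  shows "(\<integral>\<^sup>+s. ennreal (abel_kernel \<alpha> t0 t s) \<partial>lebesgue) = ennreal ((t - t0) powr \<alpha> / \<alpha>)"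
  using nn_integral_has_integral_lebesgue[OF _ has_integral_powr_diff_left[OF assms order_refl]] assms
  by (simp add: nn_integral_completion abel_kernel_def)

lemma nn_integral_abel_kernel_time:
  assumes "0 < \<alpha>"
  shows "(\<integral>\<^sup>+t. ennreal (abel_kernel \<alpha> t0 t s) * indicator {t0..t1} t \<partial>lborel)
       = ennreal ((t1 - s) powr \<alpha> / \<alpha>) * indicator {t0..t1} s"
proof (cases "s \<in> {t0..t1}")
  case True
  then have "ennreal (abel_kernel \<alpha> t0 t s) * indicator {t0..t1} t
      = ennreal (indicator {s..t1} t * (t - s) powr (\<alpha> - 1))" for t
    by (auto simp: abel_kernel_def split: split_indicator)
  then show ?thesis
    using nn_integral_has_integral_lebesgue[OF _ has_integral_powr_diff_right[OF assms, of s t1]] True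
    by simp
next
  case False
  then have "ennreal (abel_kernel \<alpha> t0 t s) * indicator {t0..t1} t = 0" for t
    by (auto simp: abel_kernel_def split: split_indicator)
  then have "(\<integral>\<^sup>+t. ennreal (abel_kernel \<alpha> t0 t s) * indicator {t0..t1} t \<partial>lborel) = 0"
    by (simp only: nn_integral_const mult_zero_left)
  then show ?thesis using False by simp
qed

text \<open>On the triangle \<open>t0 \<le> s \<le> t \<le> t1\<close> the kernel is integrated in \<open>t\<close> first.  The function \<open>g\<close> is only
  Lebesgue measurable; replacing it by a Borel function that agrees with it almost everywhere
  brings the product measure of \<open>lborel\<close> into play.\<close>

lemma nn_integral_abel_kernel_Tonelli:
  fixes g :: "real \<Rightarrow> ennreal"
  assumes \<alpha>: "0 < \<alpha>" and g: "g \<in> borel_measurable lebesgue"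
  shows "(\<integral>\<^sup>+t. (\<integral>\<^sup>+s. ennreal (abel_kernel \<alpha> t0 t s) * g s \<partial>lebesgue) * indicator {t0..t1} t \<partial>lebesgue)
       = (\<integral>\<^sup>+s. ennreal ((t1 - s) powr \<alpha> / \<alpha>) * g s * indicator {t0..t1} s \<partial>lebesgue)"
proof -
  obtain g' where g'[measurable]: "g' \<in> borel_measurable lborel" and eq: "AE s in lborel. g s = g' s"
    using completion_ex_borel_measurable[OF g] by blast
  let ?k = "\<lambda>t s. ennreal (abel_kernel \<alpha> t0 t s) * indicator {t0..t1} t * g' s"
  have "(\<integral>\<^sup>+t. (\<integral>\<^sup>+s. ennreal (abel_kernel \<alpha> t0 t s) * g s \<partial>lebesgue) * indicator {t0..t1} t \<partial>lebesgue)
      = (\<integral>\<^sup>+t. (\<integral>\<^sup>+s. ?k t s \<partial>lborel) \<partial>lborel)"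
    unfolding nn_integral_completion
  proof (intro nn_integral_cong)
    fix t :: real
    have "(\<integral>\<^sup>+s. ennreal (abel_kernel \<alpha> t0 t s) * g s \<partial>lborel)
        = (\<integral>\<^sup>+s. ennreal (abel_kernel \<alpha> t0 t s) * g' s \<partial>lborel)"
      using eq by (intro nn_integral_cong_AE) auto
    then show "(\<integral>\<^sup>+s. ennreal (abel_kernel \<alpha> t0 t s) * g s \<partial>lborel) * indicator {t0..t1} t
        = (\<integral>\<^sup>+s. ?k t s \<partial>lborel)"
      by (simp add: nn_integral_multc[symmetric] mult_ac)
        (simp add: nn_integral_cmult[symmetric] mult_ac)
  qed
  also have "\<dots> = (\<integral>\<^sup>+s. (\<integral>\<^sup>+t. ?k t s \<partial>lborel) \<partial>lborel)"
    by (rule lborel_pair.Fubini'[symmetric]) simp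
  also have "\<dots> = (\<integral>\<^sup>+s. ennreal ((t1 - s) powr \<alpha> / \<alpha>) * g s * indicator {t0..t1} s \<partial>lborel)"
  proof (rule nn_integral_cong_AE)
    have "(\<integral>\<^sup>+t. ?k t s \<partial>lborel) = ennreal ((t1 - s) powr \<alpha> / \<alpha>) * indicator {t0..t1} s * g' s" for s
      by (simp add: nn_integral_multc nn_integral_abel_kernel_time[OF \<alpha>])
    then show "AE s in lborel. (\<integral>\<^sup>+t. ?k t s \<partial>lborel) = ennreal ((t1 - s) powr \<alpha> / \<alpha>) * g s * indicator {t0..t1} s"
      using eq by (auto simp: mult_ac)
  qed
  finally show ?thesis by (simp add: nn_integral_completion)
qed

text \<open>The constant is absorbed into \<open>g\<close>: pulling it out of the outer integral directly would call for
  measurability of the inner integral in \<open>t\<close>.\<close>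

lemma nn_integral_abel_kernel_Tonelli_cmult:
  fixes g :: "real \<Rightarrow> ennreal" and \<kappa> :: ennreal
  assumes \<alpha>: "0 < \<alpha>" and g: "g \<in> borel_measurable lebesgue"
  shows "(\<integral>\<^sup>+t. \<kappa> * (\<integral>\<^sup>+s. ennreal (abel_kernel \<alpha> t0 t s) * g s \<partial>lebesgue) * indicator {t0..t1} t \<partial>lebesgue)
       = \<kappa> * (\<integral>\<^sup>+s. ennreal ((t1 - s) powr \<alpha> / \<alpha>) * g s * indicator {t0..t1} s \<partial>lebesgue)"
proof -
  have [measurable]: "(\<lambda>s. ennreal (abel_kernel \<alpha> t0 t s)) \<in> borel_measurable lebesgue" for t
    using borel_measurable_lebesgue_abel_kernel by simp
  have [measurable]: "(\<lambda>s. ennreal ((t1 - s) powr \<alpha> / \<alpha>)) \<in> borel_measurable lebesgue"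
    by (rule measurable_completion) simp
  have [measurable]: "{t0..t1} \<in> sets lebesgue" by simp
  note g[measurable]
  have "\<kappa> * (\<integral>\<^sup>+s. ennreal (abel_kernel \<alpha> t0 t s) * g s \<partial>lebesgue)
      = (\<integral>\<^sup>+s. ennreal (abel_kernel \<alpha> t0 t s) * (\<kappa> * g s) \<partial>lebesgue)" for t
    by (subst nn_integral_cmult[symmetric]) (simp_all add: mult_ac)
  moreover have "\<kappa> * (\<integral>\<^sup>+s. ennreal ((t1 - s) powr \<alpha> / \<alpha>) * g s * indicator {t0..t1} s \<partial>lebesgue)
      = (\<integral>\<^sup>+s. ennreal ((t1 - s) powr \<alpha> / \<alpha>) * (\<kappa> * g s) * indicator {t0..t1} s \<partial>lebesgue)"
    by (subst nn_integral_cmult[symmetric]) (simp_all add: mult_ac)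
  ultimately show ?thesis
    using nn_integral_abel_kernel_Tonelli[OF \<alpha>, of "\<lambda>s. \<kappa> * g s"] by simp
qed

lemma RL_integral_eq_kernel:
  "RL_integral \<alpha> t0 f t = (1 / Gamma \<alpha>) *\<^sub>R bochner_integral lebesgue (\<lambda>s. abel_kernel \<alpha> t0 t s *\<^sub>R f s)"
  unfolding RL_integral_def by (subst bochner_integral_restrict_space) (simp_all add: abel_kernel_def)

lemma complete_lebesgue: "complete_measure lebesgue"
  by (rule completion.complete_measure_axioms)

lemma norm_RL_integral_le:
  assumes "0 < \<alpha>"
  shows "ennreal (norm (RL_integral \<alpha> t0 f t))
    \<le> ennreal (1 / Gamma \<alpha>) * (\<integral>\<^sup>+s. ennreal (abel_kernel \<alpha> t0 t s) * ennreal (norm (f s)) \<partial>lebesgue)"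
proof -
  have "ennreal (norm (bochner_integral lebesgue (\<lambda>s. abel_kernel \<alpha> t0 t s *\<^sub>R f s)))
      \<le> (\<integral>\<^sup>+s. ennreal (abel_kernel \<alpha> t0 t s) * ennreal (norm (f s)) \<partial>lebesgue)"
    using norm_bochner_integral_le[OF complete_lebesgue, of "\<lambda>s. abel_kernel \<alpha> t0 t s *\<^sub>R f s"]
    by (simp add: ennreal_mult)
  then have "ennreal (1 / Gamma \<alpha>) * ennreal (norm (bochner_integral lebesgue (\<lambda>s. abel_kernel \<alpha> t0 t s *\<^sub>R f s)))
      \<le> ennreal (1 / Gamma \<alpha>) * (\<integral>\<^sup>+s. ennreal (abel_kernel \<alpha> t0 t s) * ennreal (norm (f s)) \<partial>lebesgue)"
    by (rule mult_left_mono) simp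
  then show ?thesis
    using assms unfolding RL_integral_eq_kernel by (simp add: order_less_imp_le flip: ennreal_mult)
qed

text \<open>For a nonnegative function with values on a single ray there is no cancellation, so the norm
  inequality is an equality; this is the source of the lower bounds.\<close>

lemma norm_RL_integral_scaleR_const:
  fixes c :: "'x::real_normed_vector"
  assumes \<alpha>: "0 < \<alpha>" and t: "t0 \<le> t" and h: "h \<in> borel_measurable lebesgue"
    and h01: "\<And>s. 0 \<le> h s" "\<And>s. h s \<le> 1"
  shows "ennreal (norm (RL_integral \<alpha> t0 (\<lambda>s. h s *\<^sub>R c) t))
    = ennreal (norm c / Gamma \<alpha>) * (\<integral>\<^sup>+s. ennreal (abel_kernel \<alpha> t0 t s) * ennreal (h s) \<partial>lebesgue)"
proof -
  define I where "I = (\<integral>\<^sup>+s. ennreal (abel_kernel \<alpha> t0 t s * h s) \<partial>lebesgue)"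
  have "I \<le> (\<integral>\<^sup>+s. ennreal (abel_kernel \<alpha> t0 t s) \<partial>lebesgue)"
    unfolding I_def using h01 by (intro nn_integral_mono ennreal_leI mult_left_le) simp_all
  also have "\<dots> < \<infinity>"
    by (simp add: nn_integral_abel_kernel[OF \<alpha> t])
  finally have I: "I = ennreal (enn2real I)" by simp
  have meas: "(\<lambda>s. abel_kernel \<alpha> t0 t s * h s) \<in> borel_measurable lebesgue"
    using borel_measurable_lebesgue_abel_kernel h by (rule borel_measurable_times)
  have "has_bochner_integral lebesgue (\<lambda>s. abel_kernel \<alpha> t0 t s * h s) (enn2real I)"
    by (rule has_bochner_integral_nn_integral[OF meas]) (use I I_def h01 in auto)
  from bochner_has_integral_scaleR_const[OF meas this]
  have "bochner_integral lebesgue (\<lambda>s. abel_kernel \<alpha> t0 t s *\<^sub>R h s *\<^sub>R c) = enn2real I *\<^sub>R c"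
    by (intro bochner_integral_eq complete_lebesgue) simp
  then have "norm (RL_integral \<alpha> t0 (\<lambda>s. h s *\<^sub>R c) t) = norm c / Gamma \<alpha> * enn2real I"
    using \<alpha> by (simp add: RL_integral_eq_kernel)
  then have "ennreal (norm (RL_integral \<alpha> t0 (\<lambda>s. h s *\<^sub>R c) t)) = ennreal (norm c / Gamma \<alpha>) * ennreal (enn2real I)"
    using \<alpha> by (simp add: order_less_imp_le flip: ennreal_mult)
  also have "ennreal (enn2real I) = I" by (rule I[symmetric])
  finally show ?thesis
    using h01 by (simp add: I_def ennreal_mult)
qed

section \<open>Continuity of the fractional integral of a bounded function\<close>

text \<open>Since \<open>k\<close> is monotone, the difference of the kernels has constant sign on \<open>{t0..<t}\<close> and the
  integral of its absolute value can be evaluated exactly.  The bound stated is slightly larger,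
  but symmetric in \<open>t\<close> and \<open>t'\<close> once \<open>t' - t\<close> is replaced by its absolute value.\<close>

lemma nn_integral_abel_kernel_diff_le:
  assumes \<alpha>: "0 < \<alpha>" and t: "t0 \<le> t" "t \<le> t'"
  shows "(\<integral>\<^sup>+s. ennreal \<bar>abel_kernel \<alpha> t0 t' s - abel_kernel \<alpha> t0 t s\<bar> \<partial>lebesgue)
    \<le> ennreal ((\<bar>(t' - t0) powr \<alpha> - (t - t0) powr \<alpha>\<bar> + 2 * (t' - t) powr \<alpha>) / \<alpha>)"
proof -
  \<comment> \<open>\<open>\<sigma>\<close> is the sign of the difference for \<open>s < t\<close>: \<open>k\<close> is nondecreasing if \<open>1 \<le> \<alpha>\<close> and decreasing otherwise.\<close>
  define \<sigma> :: real where "\<sigma> = (if 1 \<le> \<alpha> then 1 else - 1)"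
  define F where "F s = (if s < t then \<sigma> * ((t' - s) powr (\<alpha> - 1) - (t - s) powr (\<alpha> - 1))
    else (t' - s) powr (\<alpha> - 1))" for s
  define w where "w = \<sigma> * (((t' - t0) powr \<alpha> - (t' - t) powr \<alpha>) / \<alpha> - (t - t0) powr \<alpha> / \<alpha>)
    + (t' - t) powr \<alpha> / \<alpha>"
  have F_nonneg: "0 \<le> F s" for s
  proof (cases "1 \<le> \<alpha>")
    case True
    then show ?thesis using t by (auto simp: F_def \<sigma>_def intro!: powr_mono2)
  next
    case False
    then show ?thesis using t by (auto simp: F_def \<sigma>_def intro!: powr_mono2')
  qed
  have "(F has_integral \<sigma> * (((t' - t0) powr \<alpha> - (t' - t) powr \<alpha>) / \<alpha> - (t - t0) powr \<alpha> / \<alpha>)) {t0..t}"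
  \<comment> \<open>The two formulas differ at \<open>s = t\<close>, where \<open>0 powr (\<alpha> - 1) = 0\<close>.\<close>
  proof (rule has_integral_spike_finite[of "{t}"])
    show "((\<lambda>s. \<sigma> * ((t' - s) powr (\<alpha> - 1) - (t - s) powr (\<alpha> - 1))) has_integral
        \<sigma> * (((t' - t0) powr \<alpha> - (t' - t) powr \<alpha>) / \<alpha> - (t - t0) powr \<alpha> / \<alpha>)) {t0..t}"
      using has_integral_powr_diff_left[OF \<alpha> t] has_integral_powr_diff_left[OF \<alpha> t(1) order_refl] \<alpha>
      by (intro has_integral_mult_right has_integral_diff) simp_all
  qed (auto simp: F_def)
  moreover have "(F has_integral (t' - t) powr \<alpha> / \<alpha>) {t..t'}"
  proof (rule has_integral_eq)
    show "((\<lambda>s. (t' - s) powr (\<alpha> - 1)) has_integral (t' - t) powr \<alpha> / \<alpha>) {t..t'}"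
      using has_integral_powr_diff_left[OF \<alpha> t(2) order_refl] \<alpha> by simp
  qed (auto simp: F_def)
  ultimately have "(F has_integral w) {t0..t'}"
    unfolding w_def by (rule has_integral_combine[OF t])
  then have F: "(\<integral>\<^sup>+s. ennreal (indicator {t0..t'} s * F s) \<partial>lborel) = ennreal w"
    using nn_integral_has_integral_lebesgue[of "{t0..t'}" F w] F_nonneg by simp
  have "AE s in lborel. ennreal \<bar>abel_kernel \<alpha> t0 t' s - abel_kernel \<alpha> t0 t s\<bar> = ennreal (indicator {t0..t'} s * F s)"
    using AE_lborel_singleton[of t]
  proof eventually_elim
    fix s assume "s \<noteq> t"
    have "\<bar>abel_kernel \<alpha> t0 t' s - abel_kernel \<alpha> t0 t s\<bar> = indicator {t0..t'} s * \<bar>F s\<bar>"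
      using \<open>s \<noteq> t\<close> t
      by (auto simp: abel_kernel_def F_def \<sigma>_def abs_mult abs_minus_commute split: split_indicator)
    then show "ennreal \<bar>abel_kernel \<alpha> t0 t' s - abel_kernel \<alpha> t0 t s\<bar> = ennreal (indicator {t0..t'} s * F s)"
      using F_nonneg by simp
  qed
  then have "(\<integral>\<^sup>+s. ennreal \<bar>abel_kernel \<alpha> t0 t' s - abel_kernel \<alpha> t0 t s\<bar> \<partial>lebesgue) = ennreal w"
    unfolding nn_integral_completion F[symmetric] by (rule nn_integral_cong_AE)
  moreover have "w \<le> (\<bar>(t' - t0) powr \<alpha> - (t - t0) powr \<alpha>\<bar> + 2 * (t' - t) powr \<alpha>) / \<alpha>"
  proof -
    have "w = (\<sigma> * (((t' - t0) powr \<alpha> - (t - t0) powr \<alpha>) - (t' - t) powr \<alpha>) + (t' - t) powr \<alpha>) / \<alpha>"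
      unfolding w_def by (simp add: add_divide_distrib diff_divide_distrib right_diff_distrib)
    also have "\<dots> \<le> (\<bar>(t' - t0) powr \<alpha> - (t - t0) powr \<alpha>\<bar> + 2 * (t' - t) powr \<alpha>) / \<alpha>"
    proof (rule divide_right_mono)
      have "\<sigma> * (x - d) + d \<le> \<bar>x\<bar> + 2 * d" if "0 \<le> d" for x d :: real
        using that by (auto simp: \<sigma>_def)
      then show "\<sigma> * (((t' - t0) powr \<alpha> - (t - t0) powr \<alpha>) - (t' - t) powr \<alpha>) + (t' - t) powr \<alpha>
          \<le> \<bar>(t' - t0) powr \<alpha> - (t - t0) powr \<alpha>\<bar> + 2 * (t' - t) powr \<alpha>"
        by simp
    qed (use \<alpha> in simp)
    finally show ?thesis .
  qed
  ultimately show ?thesis by (simp add: ennreal_leI)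
qed

lemma nn_integral_scaleR_le_AE_bound:
  fixes f :: "real \<Rightarrow> 'x::real_normed_vector" and k :: "real \<Rightarrow> real"
  assumes bound: "AE s in lebesgue_on {t0..t1}. norm (f s) \<le> C" and C: "0 \<le> C"
    and supp: "\<And>s. s \<notin> {t0..t1} \<Longrightarrow> k s = 0" and k: "k \<in> borel_measurable lebesgue"
  shows "(\<integral>\<^sup>+s. ennreal (norm (k s *\<^sub>R f s)) \<partial>lebesgue) \<le> ennreal C * (\<integral>\<^sup>+s. ennreal \<bar>k s\<bar> \<partial>lebesgue)"
proof -
  have "AE s in lebesgue. s \<in> {t0..t1} \<longrightarrow> norm (f s) \<le> C"
    using bound by (subst (asm) AE_restrict_space_iff) simp_all
  then have "AE s in lebesgue. ennreal (norm (k s *\<^sub>R f s)) \<le> ennreal C * ennreal \<bar>k s\<bar>"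
  proof eventually_elim
    fix s assume *: "s \<in> {t0..t1} \<longrightarrow> norm (f s) \<le> C"
    have "\<bar>k s\<bar> * norm (f s) \<le> C * \<bar>k s\<bar>"
      using * supp[of s] by (cases "s \<in> {t0..t1}") (auto simp: mult.commute[of C] intro: mult_left_mono)
    then show "ennreal (norm (k s *\<^sub>R f s)) \<le> ennreal C * ennreal \<bar>k s\<bar>"
      using C by (simp add: ennreal_leI flip: ennreal_mult)
  qed
  then have "(\<integral>\<^sup>+s. ennreal (norm (k s *\<^sub>R f s)) \<partial>lebesgue) \<le> (\<integral>\<^sup>+s. ennreal C * ennreal \<bar>k s\<bar> \<partial>lebesgue)"
    by (rule nn_integral_mono_AE)
  also have "\<dots> = ennreal C * (\<integral>\<^sup>+s. ennreal \<bar>k s\<bar> \<partial>lebesgue)"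
    using k by (intro nn_integral_cmult) simp
  finally show ?thesis .
qed

lemma bochner_has_integral_abel_kernel:
  fixes f :: "real \<Rightarrow> 'x::banach"
  assumes \<alpha>: "0 < \<alpha>" and f: "strongly_measurable (lebesgue_on {t0..t1}) f"
    and bound: "AE s in lebesgue_on {t0..t1}. norm (f s) \<le> C" and C: "0 \<le> C"
    and t: "t0 \<le> t" "t \<le> t1"
  shows "bochner_has_integral lebesgue (\<lambda>s. abel_kernel \<alpha> t0 t s *\<^sub>R f s)
    (bochner_integral lebesgue (\<lambda>s. abel_kernel \<alpha> t0 t s *\<^sub>R f s))"
proof -
  have "strongly_measurable lebesgue (\<lambda>s. indicator {t0..t1} s *\<^sub>R f s)"
    using f by (subst (asm) strongly_measurable_restrict_space_iff) simp_all
  then have "strongly_measurable lebesgue (\<lambda>s. abel_kernel \<alpha> t0 t s *\<^sub>R indicator {t0..t1} s *\<^sub>R f s)"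
    by (rule strongly_measurable_scaleR[OF borel_measurable_imp_strongly_measurable[OF borel_measurable_lebesgue_abel_kernel]])
  moreover have "abel_kernel \<alpha> t0 t s *\<^sub>R indicator {t0..t1} s *\<^sub>R f s = abel_kernel \<alpha> t0 t s *\<^sub>R f s" for s
    using t by (auto simp: abel_kernel_def split: split_indicator)
  ultimately have "strongly_measurable lebesgue (\<lambda>s. abel_kernel \<alpha> t0 t s *\<^sub>R f s)"
    by (simp only:)
  moreover have "(\<integral>\<^sup>+s. ennreal (norm (abel_kernel \<alpha> t0 t s *\<^sub>R f s)) \<partial>lebesgue) < \<infinity>"
  proof -
    have "(\<integral>\<^sup>+s. ennreal (norm (abel_kernel \<alpha> t0 t s *\<^sub>R f s)) \<partial>lebesgue)
        \<le> ennreal C * (\<integral>\<^sup>+s. ennreal \<bar>abel_kernel \<alpha> t0 t s\<bar> \<partial>lebesgue)"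
      using t by (intro nn_integral_scaleR_le_AE_bound[OF bound C] borel_measurable_lebesgue_abel_kernel)
        (auto simp: abel_kernel_def)
    also have "\<dots> < \<infinity>"
      using nn_integral_abel_kernel[OF \<alpha> t(1)] by (simp add: ennreal_mult_less_top)
    finally show ?thesis .
  qed
  ultimately obtain y where "bochner_has_integral lebesgue (\<lambda>s. abel_kernel \<alpha> t0 t s *\<^sub>R f s) y"
    using bochner_has_integral_exists[OF complete_lebesgue] by blast
  then show ?thesis
    using bochner_integral_eq[OF complete_lebesgue] by metis
qed

text \<open>The integrals exist on all of \<open>{t0..t1}\<close>, so two values of the fractional integral may be
  subtracted; their distance is at most \<open>C / \<Gamma>(\<alpha>)\<close> times the \<open>L\<^sup>1\<close> distance of the kernels.\<close>

lemma continuous_on_RL_integral: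
  fixes f :: "real \<Rightarrow> 'x::banach"
  assumes \<alpha>: "0 < \<alpha>" and f: "strongly_measurable (lebesgue_on {t0..t1}) f"
    and bound: "AE s in lebesgue_on {t0..t1}. norm (f s) \<le> C" and C: "0 \<le> C"
  shows "continuous_on {t0..t1} (RL_integral \<alpha> t0 f)"
proof -
  define B where "B t t' = C / Gamma \<alpha> * ((\<bar>(t' - t0) powr \<alpha> - (t - t0) powr \<alpha>\<bar> + 2 * \<bar>t' - t\<bar> powr \<alpha>) / \<alpha>)" for t t'
  have le: "norm (RL_integral \<alpha> t0 f t' - RL_integral \<alpha> t0 f t) \<le> B t t'"
    if t: "t0 \<le> t" "t \<le> t'" "t' \<le> t1" for t t'
  proof -
    let ?k = "\<lambda>s. abel_kernel \<alpha> t0 t' s - abel_kernel \<alpha> t0 t s"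
    let ?d = "bochner_integral lebesgue (\<lambda>s. abel_kernel \<alpha> t0 t' s *\<^sub>R f s)
      - bochner_integral lebesgue (\<lambda>s. abel_kernel \<alpha> t0 t s *\<^sub>R f s)"
    let ?w = "(\<bar>(t' - t0) powr \<alpha> - (t - t0) powr \<alpha>\<bar> + 2 * (t' - t) powr \<alpha>) / \<alpha>"
    have "bochner_has_integral lebesgue (\<lambda>s. ?k s *\<^sub>R f s) ?d"
      using bochner_has_integral_diff[OF complete_lebesgue
          bochner_has_integral_abel_kernel[OF \<alpha> f bound C, of t'] bochner_has_integral_abel_kernel[OF \<alpha> f bound C, of t]] t
      by (simp add: scaleR_left_diff_distrib)
    then have "ennreal (norm ?d) \<le> (\<integral>\<^sup>+s. ennreal (norm (?k s *\<^sub>R f s)) \<partial>lebesgue)"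
      by (rule bochner_has_integral_norm_le[OF complete_lebesgue])
    also have "\<dots> \<le> ennreal C * (\<integral>\<^sup>+s. ennreal \<bar>?k s\<bar> \<partial>lebesgue)"
      using t by (intro nn_integral_scaleR_le_AE_bound[OF bound C] borel_measurable_diff borel_measurable_lebesgue_abel_kernel)
        (auto simp: abel_kernel_def)
    also have "\<dots> \<le> ennreal C * ennreal ?w"
      by (intro mult_left_mono nn_integral_abel_kernel_diff_le \<alpha> t) simp
    also have "\<dots> = ennreal (C * ?w)"
      using C \<alpha> by (intro ennreal_mult[symmetric]) simp_all
    finally have "norm ?d \<le> C * ?w"
      using C \<alpha> by (simp add: ennreal_le_iff)
    then have "(1 / Gamma \<alpha>) * norm ?d \<le> (1 / Gamma \<alpha>) * (C * ?w)"
      using \<alpha> by (intro mult_left_mono) (simp_all add: order_less_imp_le)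
    moreover have "RL_integral \<alpha> t0 f t' - RL_integral \<alpha> t0 f t = (1 / Gamma \<alpha>) *\<^sub>R ?d"
      by (simp only: RL_integral_eq_kernel scaleR_right_diff_distrib)
    ultimately show ?thesis
      using \<alpha> t unfolding B_def by simp
  qed
  have le': "norm (RL_integral \<alpha> t0 f t' - RL_integral \<alpha> t0 f t) \<le> B t t'"
    if "t \<in> {t0..t1}" "t' \<in> {t0..t1}" for t t'
    using le[of t t'] le[of t' t] that
    by (cases "t \<le> t'") (auto simp: norm_minus_commute abs_minus_commute B_def)
  show ?thesis
    unfolding continuous_on_def
  proof
    fix t assume t: "t \<in> {t0..t1}"
    have "continuous_on {t0..t1} (B t)"
      unfolding B_def[abs_def] using \<alpha> by (intro continuous_intros continuous_on_powr') auto
    then have "(B t \<longlongrightarrow> B t t) (at t within {t0..t1})"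
      using t by (simp add: continuous_on_def)
    then have "(B t \<longlongrightarrow> 0) (at t within {t0..t1})"
      by (simp add: B_def)
    then have "((\<lambda>t'. RL_integral \<alpha> t0 f t' - RL_integral \<alpha> t0 f t) \<longlongrightarrow> 0) (at t within {t0..t1})"
      by (rule Lim_null_comparison[rotated]) (auto simp: eventually_at_filter le'[OF t] intro!: always_eventually)
    then show "(RL_integral \<alpha> t0 f \<longlongrightarrow> RL_integral \<alpha> t0 f t) (at t within {t0..t1})"
      by (rule LIM_zero_cancel)
  qed
qed

section \<open>The operator norm\<close>

lemma Lp_norm_1: "Lp_norm 1 M f = (\<integral>\<^sup>+x. ennreal (norm (f x)) \<partial>M)"
  by (auto simp: Lp_norm_def Let_def infinity_ennreal_def less_top[symmetric])

lemma Lp_norm_infinity: "Lp_norm \<infinity> M f = esssup M (\<lambda>x. ennreal (norm (f x)))"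
  by (simp add: Lp_norm_def)

text \<open>If \<open>Lp_norm p M \<phi> = 0\<close>, the hypothesis makes the quotient \<open>0 / 0 = 0\<close>.\<close>

lemma Lp_opnorm_leI:
  fixes T :: "('a \<Rightarrow> 'b::real_normed_vector) \<Rightarrow> 'a \<Rightarrow> 'b"
  assumes "\<And>\<phi>. \<phi> \<in> Lp_space p M \<Longrightarrow> Lp_norm p M (T \<phi>) \<le> K * Lp_norm p M \<phi>"
  shows "Lp_opnorm p M T \<le> K"
  unfolding Lp_opnorm_def
proof (rule SUP_least)
  fix \<phi> :: "'a \<Rightarrow> 'b" assume "\<phi> \<in> {\<phi> \<in> Lp_space p M. \<not> (AE x in M. \<phi> x = 0)}"
  then have le: "Lp_norm p M (T \<phi>) \<le> K * Lp_norm p M \<phi>"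
    using assms by blast
  show "Lp_norm p M (T \<phi>) / Lp_norm p M \<phi> \<le> K"
  proof (cases "Lp_norm p M \<phi> = 0")
    case True
    then show ?thesis using le by simp
  next
    case False
    then show ?thesis using le by (intro divide_le_posI_ennreal) (simp_all add: mult.commute zero_less_iff_neq_zero)
  qed
qed

lemma le_Lp_opnormI:
  fixes T :: "('a \<Rightarrow> 'b::real_normed_vector) \<Rightarrow> 'a \<Rightarrow> 'b"
  assumes "strongly_measurable M \<phi>" "\<not> (AE x in M. \<phi> x = 0)"
    and "Lp_norm p M \<phi> \<noteq> 0" "Lp_norm p M \<phi> < \<infinity>"
    and le: "K * Lp_norm p M \<phi> \<le> Lp_norm p M (T \<phi>)"
  shows "K \<le> Lp_opnorm p M T"
proof -
  have "K = K * Lp_norm p M \<phi> / Lp_norm p M \<phi>"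
    using assms(3,4) by (intro ennreal_mult_divide_eq[symmetric]) simp_all
  also have "\<dots> \<le> Lp_norm p M (T \<phi>) / Lp_norm p M \<phi>"
    by (rule divide_right_mono_ennreal[OF le])
  also have "\<dots> \<le> Lp_opnorm p M T"
    unfolding Lp_opnorm_def using assms by (intro SUP_upper) (simp add: Lp_space_def)
  finally show ?thesis .
qed

lemma Gamma_plus1_pos: "0 < \<alpha> \<Longrightarrow> Gamma (\<alpha> + 1) = \<alpha> * Gamma (\<alpha> :: real)"
  by (intro Gamma_plus1) (auto elim!: nonpos_Ints_cases)

text \<open>By Tonelli's theorem each \<open>s\<close> contributes with weight \<open>(t1 - s) powr \<alpha> / \<Gamma>(\<alpha> + 1)\<close>, which is largest
  at \<open>s = t0\<close>.\<close>

lemma RL_opnorm_1_le: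
  assumes \<alpha>: "0 < \<alpha>"
  shows "Lp_opnorm 1 (lebesgue_on {t0..t1}) (RL_integral \<alpha> t0 :: (real \<Rightarrow> 'x::banach) \<Rightarrow> real \<Rightarrow> 'x)
    \<le> ennreal ((t1 - t0) powr \<alpha> / Gamma (\<alpha> + 1))"
proof (rule Lp_opnorm_leI)
  fix \<phi> :: "real \<Rightarrow> 'x" assume "\<phi> \<in> Lp_space 1 (lebesgue_on {t0..t1})"
  then have "strongly_measurable lebesgue (\<lambda>s. indicator {t0..t1} s *\<^sub>R \<phi> s)"
    unfolding Lp_space_def by (simp add: strongly_measurable_restrict_space_iff)
  from strongly_measurable_norm[OF complete_lebesgue this]
  have [measurable]: "(\<lambda>s. indicator {t0..t1} s * norm (\<phi> s)) \<in> borel_measurable lebesgue"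
    by simp
  define g where "g s = ennreal (indicator {t0..t1} s * norm (\<phi> s))" for s
  have g[measurable]: "g \<in> borel_measurable lebesgue"
    unfolding g_def by measurable
  have G: "0 < Gamma \<alpha>" using \<alpha> by simp
  have "Lp_norm 1 (lebesgue_on {t0..t1}) (RL_integral \<alpha> t0 \<phi>)
      = (\<integral>\<^sup>+t. ennreal (norm (RL_integral \<alpha> t0 \<phi> t)) * indicator {t0..t1} t \<partial>lebesgue)"
    by (simp add: Lp_norm_1 nn_integral_restrict_space)
  also have "\<dots> \<le> (\<integral>\<^sup>+t. ennreal (1 / Gamma \<alpha>) * (\<integral>\<^sup>+s. ennreal (abel_kernel \<alpha> t0 t s) * g s \<partial>lebesgue) * indicator {t0..t1} t \<partial>lebesgue)"
  proof (rule nn_integral_mono)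
    fix t
    have "ennreal (norm (RL_integral \<alpha> t0 \<phi> t))
        \<le> ennreal (1 / Gamma \<alpha>) * (\<integral>\<^sup>+s. ennreal (abel_kernel \<alpha> t0 t s) * g s \<partial>lebesgue)" if "t \<le> t1"
    proof -
      have "ennreal (abel_kernel \<alpha> t0 t s) * g s = ennreal (abel_kernel \<alpha> t0 t s) * ennreal (norm (\<phi> s))" for s
        using that by (auto simp: abel_kernel_def g_def split: split_indicator)
      then show ?thesis using norm_RL_integral_le[OF \<alpha>, of t0 \<phi> t] by simp
    qed
    then show "ennreal (norm (RL_integral \<alpha> t0 \<phi> t)) * indicator {t0..t1} t
        \<le> ennreal (1 / Gamma \<alpha>) * (\<integral>\<^sup>+s. ennreal (abel_kernel \<alpha> t0 t s) * g s \<partial>lebesgue) * indicator {t0..t1} t"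
      by (auto split: split_indicator)
  qed
  also have "\<dots> = ennreal (1 / Gamma \<alpha>) * (\<integral>\<^sup>+s. ennreal ((t1 - s) powr \<alpha> / \<alpha>) * g s * indicator {t0..t1} s \<partial>lebesgue)"
    by (rule nn_integral_abel_kernel_Tonelli_cmult[OF \<alpha> g])
  also have "\<dots> \<le> ennreal (1 / Gamma \<alpha>) * (\<integral>\<^sup>+s. ennreal ((t1 - t0) powr \<alpha> / \<alpha>) * g s \<partial>lebesgue)"
    using \<alpha> by (intro mult_left_mono nn_integral_mono)
      (auto split: split_indicator intro!: mult_right_mono ennreal_leI divide_right_mono powr_mono2)
  also have "\<dots> = ennreal (1 / Gamma \<alpha>) * (ennreal ((t1 - t0) powr \<alpha> / \<alpha>) * (\<integral>\<^sup>+s. g s \<partial>lebesgue))"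
    by (simp add: nn_integral_cmult)
  also have "\<dots> = ennreal ((t1 - t0) powr \<alpha> / Gamma (\<alpha> + 1)) * (\<integral>\<^sup>+s. g s \<partial>lebesgue)"
    using \<alpha> G by (simp add: Gamma_plus1_pos mult.assoc[symmetric] mult.commute[of \<alpha>] flip: ennreal_mult)
  also have "(\<integral>\<^sup>+s. g s \<partial>lebesgue) = Lp_norm 1 (lebesgue_on {t0..t1}) \<phi>"
    by (simp add: Lp_norm_1 nn_integral_restrict_space g_def ennreal_mult ennreal_indicator mult.commute)
  finally show "Lp_norm 1 (lebesgue_on {t0..t1}) (RL_integral \<alpha> t0 \<phi>)
      \<le> ennreal ((t1 - t0) powr \<alpha> / Gamma (\<alpha> + 1)) * Lp_norm 1 (lebesgue_on {t0..t1}) \<phi>" .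
qed

text \<open>The pointwise bound is the mass of the kernel at time \<open>t\<close>, which grows with \<open>t\<close>; measurability
  comes from continuity.\<close>

lemma RL_opnorm_infinity_le:
  assumes \<alpha>: "0 < \<alpha>"
  shows "Lp_opnorm \<infinity> (lebesgue_on {t0..t1}) (RL_integral \<alpha> t0 :: (real \<Rightarrow> 'x::banach) \<Rightarrow> real \<Rightarrow> 'x)
    \<le> ennreal ((t1 - t0) powr \<alpha> / Gamma (\<alpha> + 1))"
proof (rule Lp_opnorm_leI)
  fix \<phi> :: "real \<Rightarrow> 'x" assume "\<phi> \<in> Lp_space \<infinity> (lebesgue_on {t0..t1})"
  then have \<phi>: "strongly_measurable (lebesgue_on {t0..t1}) \<phi>"
    and fin: "Lp_norm \<infinity> (lebesgue_on {t0..t1}) \<phi> < \<infinity>"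
    by (simp_all add: Lp_space_def)
  define C where "C = enn2real (Lp_norm \<infinity> (lebesgue_on {t0..t1}) \<phi>)"
  have C: "0 \<le> C" and C_eq: "Lp_norm \<infinity> (lebesgue_on {t0..t1}) \<phi> = ennreal C"
    using fin by (simp_all add: C_def)
  have "AE s in lebesgue_on {t0..t1}. ennreal (norm (\<phi> s)) \<le> ennreal C"
    using esssup_AE unfolding C_eq[symmetric] Lp_norm_infinity .
  then have bound: "AE s in lebesgue_on {t0..t1}. norm (\<phi> s) \<le> C"
    using C by simp
  have G: "0 < Gamma \<alpha>" using \<alpha> by simp
  have "Lp_norm \<infinity> (lebesgue_on {t0..t1}) (RL_integral \<alpha> t0 \<phi>) \<le> ennreal ((t1 - t0) powr \<alpha> / Gamma (\<alpha> + 1) * C)"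
    unfolding Lp_norm_infinity
  proof (rule esssup_I)
    have "continuous_on {t0..t1} (\<lambda>t. norm (RL_integral \<alpha> t0 \<phi> t))"
      by (intro continuous_on_norm continuous_on_RL_integral[OF \<alpha> \<phi> bound C])
    then have "(\<lambda>t. norm (RL_integral \<alpha> t0 \<phi> t)) \<in> borel_measurable (lebesgue_on {t0..t1})"
      by (rule continuous_imp_measurable_on_sets_lebesgue) simp
    then show "(\<lambda>t. ennreal (norm (RL_integral \<alpha> t0 \<phi> t))) \<in> borel_measurable (lebesgue_on {t0..t1})"
      by simp
    show "AE t in lebesgue_on {t0..t1}. ennreal (norm (RL_integral \<alpha> t0 \<phi> t)) \<le> ennreal ((t1 - t0) powr \<alpha> / Gamma (\<alpha> + 1) * C)"
    proof (rule AE_I2)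
      fix t assume "t \<in> space (lebesgue_on {t0..t1})"
      then have t: "t0 \<le> t" "t \<le> t1" by auto
      have "ennreal (norm (RL_integral \<alpha> t0 \<phi> t))
          \<le> ennreal (1 / Gamma \<alpha>) * (\<integral>\<^sup>+s. ennreal (abel_kernel \<alpha> t0 t s) * ennreal (norm (\<phi> s)) \<partial>lebesgue)"
        by (rule norm_RL_integral_le[OF \<alpha>])
      also have "(\<integral>\<^sup>+s. ennreal (abel_kernel \<alpha> t0 t s) * ennreal (norm (\<phi> s)) \<partial>lebesgue)
          = (\<integral>\<^sup>+s. ennreal (norm (abel_kernel \<alpha> t0 t s *\<^sub>R \<phi> s)) \<partial>lebesgue)"
        by (simp add: ennreal_mult)
      also have "\<dots> \<le> ennreal C * (\<integral>\<^sup>+s. ennreal \<bar>abel_kernel \<alpha> t0 t s\<bar> \<partial>lebesgue)"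
        using t by (intro nn_integral_scaleR_le_AE_bound[OF bound C] borel_measurable_lebesgue_abel_kernel)
          (auto simp: abel_kernel_def)
      also have "(\<integral>\<^sup>+s. ennreal \<bar>abel_kernel \<alpha> t0 t s\<bar> \<partial>lebesgue) = ennreal ((t - t0) powr \<alpha> / \<alpha>)"
        using nn_integral_abel_kernel[OF \<alpha> t(1)] by simp
      finally have "ennreal (norm (RL_integral \<alpha> t0 \<phi> t)) \<le> ennreal (1 / Gamma \<alpha>) * (ennreal C * ennreal ((t - t0) powr \<alpha> / \<alpha>))"
        by (simp add: mult_left_mono)
      also have "\<dots> = ennreal ((t - t0) powr \<alpha> / Gamma (\<alpha> + 1) * C)"
        using \<alpha> G C by (simp add: Gamma_plus1_pos mult_ac flip: ennreal_mult)
      also have "\<dots> \<le> ennreal ((t1 - t0) powr \<alpha> / Gamma (\<alpha> + 1) * C)"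
        using \<alpha> t C by (intro ennreal_leI mult_right_mono divide_right_mono powr_mono2) (auto simp: order_less_imp_le)
      finally show "ennreal (norm (RL_integral \<alpha> t0 \<phi> t)) \<le> ennreal ((t1 - t0) powr \<alpha> / Gamma (\<alpha> + 1) * C)" .
    qed
  qed
  also have "\<dots> = ennreal ((t1 - t0) powr \<alpha> / Gamma (\<alpha> + 1)) * ennreal C"
    using \<alpha> C by (intro ennreal_mult) (simp_all add: order_less_imp_le)
  finally show "Lp_norm \<infinity> (lebesgue_on {t0..t1}) (RL_integral \<alpha> t0 \<phi>)
      \<le> ennreal ((t1 - t0) powr \<alpha> / Gamma (\<alpha> + 1)) * Lp_norm \<infinity> (lebesgue_on {t0..t1}) \<phi>"
    unfolding C_eq .
qed

text \<open>Near the right end point there is a point outside any given null set.  It replaces the end point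
  itself, at which a property that holds almost everywhere may fail.\<close>

lemma AE_lebesgue_on_interval_imp_ex:
  fixes a b u :: real
  assumes "AE t in lebesgue_on {a..b}. P t" "a \<le> u" "u < b"
  shows "\<exists>t\<in>{u..b}. P t"
proof (rule ccontr)
  assume neg: "\<not> (\<exists>t\<in>{u..b}. P t)"
  have "AE t in lebesgue. t \<in> {a..b} \<longrightarrow> P t"
    using assms(1) by (subst (asm) AE_restrict_space_iff) simp_all
  then have "AE t in lebesgue. t \<notin> {u..b}"
    by eventually_elim (use neg assms(2) in auto)
  then have "{u..b} \<in> null_sets lebesgue"
    by (subst AE_iff_null_sets) simp_all
  then show False
    using assms(3) by (auto simp: null_sets_def)
qed

text \<open>The constant function \<open>c\<close> is the test function: the norm of its fractional integral is
  nondecreasing in \<open>t\<close>, hence at least its value at \<open>u\<close> on \<open>{u..t1}\<close>, which is not a null set.\<close>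

lemma le_RL_opnorm_infinity:
  fixes c :: "'x::banach"
  assumes \<alpha>: "0 < \<alpha>" and u: "t0 < u" "u < t1" and c: "c \<noteq> 0"
  shows "ennreal ((u - t0) powr \<alpha> / Gamma (\<alpha> + 1))
    \<le> Lp_opnorm \<infinity> (lebesgue_on {t0..t1}) (RL_integral \<alpha> t0 :: (real \<Rightarrow> 'x) \<Rightarrow> real \<Rightarrow> 'x)"
proof (rule le_Lp_opnormI)
  let ?M = "lebesgue_on {t0..t1}" and ?\<phi> = "\<lambda>_::real. c"
  have M: "emeasure ?M (space ?M) = ennreal (t1 - t0)"
    using u by (simp add: emeasure_restrict_space)
  have norm_\<phi>: "Lp_norm \<infinity> ?M ?\<phi> = ennreal (norm c)"
    unfolding Lp_norm_infinity by (rule esssup_const) (use M u in simp)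
  show "strongly_measurable ?M ?\<phi>"
    by (simp add: simple_function_imp_strongly_measurable)
  show "\<not> (AE x in ?M. ?\<phi> x = 0)"
    using AE_lebesgue_on_interval_imp_ex[where P = "\<lambda>_. c = 0" and a = t0 and b = t1 and u = u] c u by auto
  show "Lp_norm \<infinity> ?M ?\<phi> \<noteq> 0" "Lp_norm \<infinity> ?M ?\<phi> < \<infinity>"
    unfolding norm_\<phi> using c by simp_all
  have G: "0 < Gamma \<alpha>" using \<alpha> by simp
  have RL: "ennreal (norm (RL_integral \<alpha> t0 ?\<phi> t)) = ennreal ((t - t0) powr \<alpha> / Gamma (\<alpha> + 1)) * ennreal (norm c)"
    if "t0 \<le> t" for t
  proof -
    have "ennreal (norm (RL_integral \<alpha> t0 ?\<phi> t)) = ennreal (norm c / Gamma \<alpha>) * ennreal ((t - t0) powr \<alpha> / \<alpha>)"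
      using norm_RL_integral_scaleR_const[OF \<alpha> that, of "\<lambda>_. 1" c] nn_integral_abel_kernel[OF \<alpha> that] by simp
    also have "\<dots> = ennreal (norm c / Gamma \<alpha> * ((t - t0) powr \<alpha> / \<alpha>))"
      using \<alpha> G by (intro ennreal_mult[symmetric]) simp_all
    also have "norm c / Gamma \<alpha> * ((t - t0) powr \<alpha> / \<alpha>) = (t - t0) powr \<alpha> / Gamma (\<alpha> + 1) * norm c"
      by (simp add: Gamma_plus1_pos[OF \<alpha>] mult_ac)
    also have "ennreal \<dots> = ennreal ((t - t0) powr \<alpha> / Gamma (\<alpha> + 1)) * ennreal (norm c)"
      using \<alpha> by (intro ennreal_mult) (simp_all add: order_less_imp_le)
    finally show ?thesis .
  qed
  have "AE t in ?M. ennreal (norm (RL_integral \<alpha> t0 ?\<phi> t)) \<le> Lp_norm \<infinity> ?M (RL_integral \<alpha> t0 ?\<phi>)"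
    unfolding Lp_norm_infinity by (rule esssup_AE)
  from AE_lebesgue_on_interval_imp_ex[OF this, where u = u] u
  obtain t where t: "u \<le> t" "t \<le> t1"
    and le: "ennreal (norm (RL_integral \<alpha> t0 ?\<phi> t)) \<le> Lp_norm \<infinity> ?M (RL_integral \<alpha> t0 ?\<phi>)"
    by auto
  have "ennreal ((u - t0) powr \<alpha> / Gamma (\<alpha> + 1)) \<le> ennreal ((t - t0) powr \<alpha> / Gamma (\<alpha> + 1))"
    using \<alpha> u t by (intro ennreal_leI divide_right_mono powr_mono2) (auto simp: order_less_imp_le)
  then show "ennreal ((u - t0) powr \<alpha> / Gamma (\<alpha> + 1)) * Lp_norm \<infinity> ?M ?\<phi> \<le> Lp_norm \<infinity> ?M (RL_integral \<alpha> t0 ?\<phi>)"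
    unfolding norm_\<phi> using le RL[of t] t u by (auto elim!: order_trans[rotated] intro!: mult_right_mono)
qed

text \<open>The test function is \<open>c\<close> on \<open>{t0..b}\<close> and \<open>0\<close> elsewhere, where \<open>b = t0 + t1 - u\<close> is the reflection
  of \<open>u\<close>.  Every \<open>s\<close> in this interval contributes with weight at least
  \<open>(t1 - b) powr \<alpha> / \<Gamma>(\<alpha> + 1)\<close>, and \<open>t1 - b = u - t0\<close>.\<close>

lemma le_RL_opnorm_1:
  fixes c :: "'x::banach"
  assumes \<alpha>: "0 < \<alpha>" and u: "t0 < u" "u < t1" and c: "c \<noteq> 0"
  shows "ennreal ((u - t0) powr \<alpha> / Gamma (\<alpha> + 1))
    \<le> Lp_opnorm 1 (lebesgue_on {t0..t1}) (RL_integral \<alpha> t0 :: (real \<Rightarrow> 'x) \<Rightarrow> real \<Rightarrow> 'x)"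
proof (rule le_Lp_opnormI)
  define b where "b = t0 + t1 - u"
  have b: "t0 < b" "b < t1" "u - t0 = t1 - b"
    using u by (simp_all add: b_def)
  let ?M = "lebesgue_on {t0..t1}" and ?\<phi> = "\<lambda>s. indicator {t0..b} s *\<^sub>R c"
  have G: "0 < Gamma \<alpha>" using \<alpha> by simp
  have ind: "(indicator {t0..b} :: real \<Rightarrow> real) \<in> borel_measurable lebesgue"
    by (rule borel_measurable_indicator) simp
  have norm_\<phi>: "Lp_norm 1 ?M ?\<phi> = ennreal (norm c) * ennreal (b - t0)"
  proof -
    have "Lp_norm 1 ?M ?\<phi> = (\<integral>\<^sup>+s. ennreal (norm c) * indicator {t0..b} s \<partial>lebesgue)"
      unfolding Lp_norm_1 using b by (subst nn_integral_restrict_space) (auto intro!: nn_integral_cong split: split_indicator)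
    also have "\<dots> = ennreal (norm c) * ennreal (b - t0)"
      using b by (subst nn_integral_cmult_indicator) simp_all
    finally show ?thesis .
  qed
  show "strongly_measurable ?M ?\<phi>"
  proof -
    have "{t0..b} \<inter> space ?M \<in> sets ?M"
      using b by (subst sets_restrict_space_iff) simp_all
    then show ?thesis
      by (intro simple_function_imp_strongly_measurable simple_function_indicator_scaleR) simp_all
  qed
  show "Lp_norm 1 ?M ?\<phi> \<noteq> 0" "Lp_norm 1 ?M ?\<phi> < \<infinity>"
    using c b by (simp_all add: norm_\<phi> ennreal_mult_less_top)
  show "\<not> (AE x in ?M. ?\<phi> x = 0)"
  proof
    assume "AE x in ?M. ?\<phi> x = 0"
    then have "Lp_norm 1 ?M ?\<phi> = (\<integral>\<^sup>+x. 0 \<partial>?M)"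
      unfolding Lp_norm_1 by (intro nn_integral_cong_AE) auto
    then show False using \<open>Lp_norm 1 ?M ?\<phi> \<noteq> 0\<close> by simp
  qed
  have "ennreal ((u - t0) powr \<alpha> / Gamma (\<alpha> + 1)) * Lp_norm 1 ?M ?\<phi>
      = ennreal (norm c / Gamma \<alpha>) * (\<integral>\<^sup>+s. ennreal ((t1 - b) powr \<alpha> / \<alpha>) * indicator {t0..b} s \<partial>lebesgue)"
    using \<alpha> G b by (subst nn_integral_cmult_indicator) (simp_all add: norm_\<phi> Gamma_plus1_pos mult_ac flip: ennreal_mult)
  also have "\<dots> \<le> ennreal (norm c / Gamma \<alpha>) *
      (\<integral>\<^sup>+s. ennreal ((t1 - s) powr \<alpha> / \<alpha>) * ennreal (indicator {t0..b} s) * indicator {t0..t1} s \<partial>lebesgue)"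
    using \<alpha> b by (intro mult_left_mono nn_integral_mono)
      (auto split: split_indicator intro!: ennreal_leI divide_right_mono powr_mono2)
  also have "\<dots> = (\<integral>\<^sup>+t. ennreal (norm c / Gamma \<alpha>) *
      (\<integral>\<^sup>+s. ennreal (abel_kernel \<alpha> t0 t s) * ennreal (indicator {t0..b} s) \<partial>lebesgue) * indicator {t0..t1} t \<partial>lebesgue)"
    by (subst nn_integral_abel_kernel_Tonelli_cmult[OF \<alpha>]) (simp_all add: ind)
  also have "\<dots> = (\<integral>\<^sup>+t. ennreal (norm (RL_integral \<alpha> t0 ?\<phi> t)) * indicator {t0..t1} t \<partial>lebesgue)"
    using norm_RL_integral_scaleR_const[OF \<alpha>, of t0 _ "indicator {t0..b}" c] ind
    by (intro nn_integral_cong) (auto split: split_indicator)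
  also have "\<dots> = Lp_norm 1 ?M (RL_integral \<alpha> t0 ?\<phi>)"
    by (simp add: Lp_norm_1 nn_integral_restrict_space)
  finally show "ennreal ((u - t0) powr \<alpha> / Gamma (\<alpha> + 1)) * Lp_norm 1 ?M ?\<phi> \<le> Lp_norm 1 ?M (RL_integral \<alpha> t0 ?\<phi>)" .
qed

theorem theorem33:
  fixes t0 t1 \<alpha> :: real and p :: ennreal
  assumes "t0 < t1"
    and "(UNIV :: 'x::banach set) \<noteq> {0}"
    and "\<alpha> > 0"
    and "p = 1 \<or> p = \<infinity>"
  shows "Lp_opnorm p (lebesgue_on {t0..t1})
           (RL_integral \<alpha> t0 :: (real \<Rightarrow> 'x) \<Rightarrow> real \<Rightarrow> 'x)
         = ennreal ((t1 - t0) powr \<alpha> / Gamma (\<alpha> + 1))"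
proof (rule antisym)
  let ?N = "Lp_opnorm p (lebesgue_on {t0..t1}) (RL_integral \<alpha> t0 :: (real \<Rightarrow> 'x) \<Rightarrow> real \<Rightarrow> 'x)"
  show "?N \<le> ennreal ((t1 - t0) powr \<alpha> / Gamma (\<alpha> + 1))"
    using RL_opnorm_1_le RL_opnorm_infinity_le assms by blast
  obtain c :: 'x where "c \<noteq> 0"
    using assms(2) by auto
  then have le: "ennreal ((u - t0) powr \<alpha> / Gamma (\<alpha> + 1)) \<le> ?N" if "t0 < u" "u < t1" for u
    using le_RL_opnorm_1 le_RL_opnorm_infinity assms(3,4) that by blast
  show "ennreal ((t1 - t0) powr \<alpha> / Gamma (\<alpha> + 1)) \<le> ?N"
  proof (rule tendsto_upperbound)
    show "((\<lambda>u. ennreal ((u - t0) powr \<alpha> / Gamma (\<alpha> + 1))) \<longlongrightarrow> ennreal ((t1 - t0) powr \<alpha> / Gamma (\<alpha> + 1))) (at_left t1)"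
      using assms(1,3) by (intro tendsto_ennrealI tendsto_intros) (auto simp: Gamma_eq_zero_iff elim!: nonpos_Ints_cases)
    show "\<forall>\<^sub>F u in at_left t1. ennreal ((u - t0) powr \<alpha> / Gamma (\<alpha> + 1)) \<le> ?N"
      using le assms(1) by (auto simp: eventually_at_left_field)
  qed simp
qed

end
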